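(* Let $F$ be a field, let $X$ be a finite set with $\#X\ge 2$, and let $A$ be either the free associative algebra over $F$ with free generating set $X$ or the group algebra over $F$ of the free group with basis $X$. Then one can choose a finitely generated distorted subalgebra $B$ of $A$ in such a way that none of the distortion functions for $B$ in $A$ is bounded from above by any recursive function.
   Context: Algebras are unital associative algebras. The degree filtration $\{A_n\}_{n\ge0}$ of an algebra $A$ generated by a finite set $Y$ is given by letting $A_n$ be the linear span of all products of at most $n$ elements of $Y$ (the empty product being $1$). If $B$ is a finitely generated subalgebra of a finitely generated algebra $A$, a distortion function for $B$ in $A$ is a function $n\mapsto\min\{m\mid B\cap A_n\subset B_m\}$, where $\{A_n\}$ and $\{B_n\}$ are degree filtrations of $A$ and $B$ defined by some finite generating sets of $A$ and $B$ respectively. $B$ is undistorted in $A$ if, for degree filtrations $\{A_n\}$ and $\{B_n\}$, there is an integer $t>0$ with $B_n\subset A_{tn}$ and $B\cap A_n\subset B_{tn}$ for all $n\ge 0$ (independent of the choice of finite generating sets); otherwise $B$ is distorted. *)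

theory Defs
  imports Complex_Main "HOL-Library.Poly_Mapping"
begin

section \<open>Degree filtrations and distortion\<close>

locale unital_algebra = vector_space scale
  for scale :: "'f::field \<Rightarrow> 'a::ring_1 \<Rightarrow> 'a" (infixr \<open>*s\<close> 75) +
  assumes scale_mult_left: "(c *s x) * y = c *s (x * y)"
    and scale_mult_right: "x * (c *s y) = c *s (x * y)"
begin

definition subalgebra :: "'a set \<Rightarrow> bool" where
  "subalgebra B \<longleftrightarrow> subspace B \<and> 1 \<in> B \<and> (\<forall>x\<in>B. \<forall>y\<in>B. x * y \<in> B)"

definition finite_generating_set :: "'a set \<Rightarrow> 'a set \<Rightarrow> bool" where
  "finite_generating_set B Y \<longleftrightarrow> finite Y \<and> subalgebra hull Y = B"

definition finitely_generated :: "'a set \<Rightarrow> bool" where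
  "finitely_generated B \<longleftrightarrow> (\<exists>Y. finite_generating_set B Y)"

definition filtration :: "'a set \<Rightarrow> nat \<Rightarrow> 'a set" where
  "filtration Y n = span {prod_list ys | ys. set ys \<subseteq> Y \<and> length ys \<le> n}"

text \<open>The set under \<open>LEAST\<close> is never empty here: \<open>filtration Y n\<close> is finite-dimensional, and the
  increasing subspaces \<open>filtration Z m\<close> exhaust \<open>B\<close>.\<close>

definition distortion_function :: "'a set \<Rightarrow> 'a set \<Rightarrow> (nat \<Rightarrow> nat) \<Rightarrow> bool" where
  "distortion_function A B d \<longleftrightarrow>
    (\<exists>Y Z. finite_generating_set A Y \<and> finite_generating_set B Z \<and>
      d = (\<lambda>n. LEAST m. B \<inter> filtration Y n \<subseteq> filtration Z m))"

text \<open>Whether such a \<open>t\<close> exists does not depend on the generating sets \<open>Y\<close> and \<open>Z\<close>; with the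
  existential quantifier, \<open>distorted\<close> says that it fails to exist for every choice of them.\<close>

definition undistorted :: "'a set \<Rightarrow> 'a set \<Rightarrow> bool" where
  "undistorted A B \<longleftrightarrow>
    (\<exists>Y Z. finite_generating_set A Y \<and> finite_generating_set B Z \<and>
      (\<exists>t>0. \<forall>n. filtration Z n \<subseteq> filtration Y (t * n) \<and>
        B \<inter> filtration Y n \<subseteq> filtration Z (t * n)))"

definition distorted :: "'a set \<Rightarrow> 'a set \<Rightarrow> bool" where
  "distorted A B \<longleftrightarrow> \<not> undistorted A B"

end


section \<open>Monoid algebras\<close>

text \<open>For a monoid \<open>'m\<close> in additive notation, the ring \<open>'m \<Rightarrow>\<^sub>0 'f\<close> with its convolution
  product is the monoid algebra of \<open>'m\<close> over \<open>'f\<close>; \<open>Poly_Mapping.single w 1\<close> is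
  the basis element \<open>w\<close>.\<close>

definition scale :: "'f::field \<Rightarrow> ('m::monoid_add \<Rightarrow>\<^sub>0 'f) \<Rightarrow> ('m \<Rightarrow>\<^sub>0 'f)" where
  "scale c p = Poly_Mapping.map ((*) c) p"

lemma lookup_scale [simp]: "Poly_Mapping.lookup (scale c p) w = c * Poly_Mapping.lookup p w"
  by (simp add: scale_def Poly_Mapping.map.rep_eq when_def)

lemma scale_conv_mult: "scale c p = Poly_Mapping.single 0 c * p"
  unfolding scale_def by (rule mult_map_scale_conv_mult)

lemma single_zero_mult_commute:
  fixes c :: "'f::field" and p :: "'m::monoid_add \<Rightarrow>\<^sub>0 'f"
  shows "Poly_Mapping.single 0 c * p = p * Poly_Mapping.single 0 c"
proof (rule poly_mapping_eqI)
  fix k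
  have "Poly_Mapping.lookup (p * Poly_Mapping.single 0 c) k = Poly_Mapping.lookup p k * c"
  proof -
    have "(\<Sum>q. Poly_Mapping.lookup (Poly_Mapping.single 0 c) q when k = l + q) = (c when l = k)"
      for l
    proof -
      have "(\<lambda>q. Poly_Mapping.lookup (Poly_Mapping.single 0 c) q when k = l + q) =
          (\<lambda>q. (c when k = l) when q = 0)"
        by (auto simp: lookup_single when_def)
      then show ?thesis
        by (simp only: Sum_any_when_equal eq_commute[of k l])
    qed
    then show ?thesis
      by (simp add: lookup_mult mult_when)
  qed
  then show "Poly_Mapping.lookup (Poly_Mapping.single 0 c * p) k =
      Poly_Mapping.lookup (p * Poly_Mapping.single 0 c) k"
    by (simp flip: scale_conv_mult)
qed

global_interpretation monoid_algebra:
  unital_algebra "scale :: 'f::field \<Rightarrow> ('m::monoid_add \<Rightarrow>\<^sub>0 'f) \<Rightarrow> _"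
proof
  fix c :: 'f and x y :: "'m \<Rightarrow>\<^sub>0 'f"
  show "scale c x * y = scale c (x * y)"
    by (simp add: scale_conv_mult mult.assoc)
  show "x * scale c y = scale c (x * y)"
    by (simp add: scale_conv_mult single_zero_mult_commute mult.assoc)
qed (auto intro!: poly_mapping_eqI simp: lookup_add algebra_simps)


section \<open>Free monoids and the free associative algebra\<close>

datatype 'x free_monoid = Word (letters: "'x list")

instantiation free_monoid :: (type) monoid_add
begin

definition "0 = Word []"

definition "u + v = Word (letters u @ letters v)"

instance
  by standard (simp_all add: zero_free_monoid_def plus_free_monoid_def)

end

type_synonym ('x, 'f) free_algebra = "'x free_monoid \<Rightarrow>\<^sub>0 'f"


section \<open>Free groups and their group algebras\<close>

text \<open>A letter \<open>(x, True)\<close> stands for the generator \<open>x\<close>, and \<open>(x, False)\<close> for its inverse.\<close>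

inductive free_group_eq :: "('x \<times> bool) list \<Rightarrow> ('x \<times> bool) list \<Rightarrow> bool" where
  refl: "free_group_eq u u"
| sym: "free_group_eq u v \<Longrightarrow> free_group_eq v u"
| trans: "free_group_eq u v \<Longrightarrow> free_group_eq v w \<Longrightarrow> free_group_eq u w"
| cancel: "free_group_eq (u @ (x, b) # (x, \<not> b) # v) (u @ v)"

quotient_type 'x free_group = "('x \<times> bool) list" / free_group_eq
  by (intro equivpI reflpI sympI transpI) (fact free_group_eq.intros)+

lemma free_group_eq_context:
  "free_group_eq u v \<Longrightarrow> free_group_eq (p @ u @ q) (p @ v @ q)"
proof (induction rule: free_group_eq.induct)
  case (cancel u x b v)
  show ?case
    using free_group_eq.cancel[of "p @ u" x b "v @ q"] by simp
qed (blast intro: free_group_eq.intros)+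

lemma free_group_eq_append:
  assumes "free_group_eq u u'" "free_group_eq v v'"
  shows "free_group_eq (u @ v) (u' @ v')"
  using free_group_eq_context[OF assms(1), of "[]" v] free_group_eq_context[OF assms(2), of u' "[]"]
  by (auto intro: free_group_eq.trans)

definition inverse_word :: "('x \<times> bool) list \<Rightarrow> ('x \<times> bool) list" where
  "inverse_word u = rev (map (\<lambda>(x, b). (x, \<not> b)) u)"

lemma free_group_eq_inverse_word:
  "free_group_eq u v \<Longrightarrow> free_group_eq (inverse_word u) (inverse_word v)"
proof (induction rule: free_group_eq.induct)
  case (cancel u x b v)
  show ?case
    using free_group_eq.cancel[of "inverse_word v" x b "inverse_word u"]
    by (simp add: inverse_word_def)
qed (blast intro: free_group_eq.intros)+

lemma inverse_word_append: "free_group_eq (inverse_word u @ u) []"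
proof (induction u)
  case Nil
  show ?case
    by (simp add: inverse_word_def free_group_eq.refl)
next
  case (Cons a u)
  obtain x b where "a = (x, b)"
    by fastforce
  then show ?case
    using free_group_eq.cancel[of "inverse_word u" x "\<not> b" u] Cons
    by (auto simp: inverse_word_def intro: free_group_eq.trans)
qed

instantiation free_group :: (type) group_add
begin

lift_definition zero_free_group :: "'a free_group" is "[]" .

lift_definition plus_free_group :: "'a free_group \<Rightarrow> 'a free_group \<Rightarrow> 'a free_group" is "(@)"
  by (rule free_group_eq_append)

lift_definition uminus_free_group :: "'a free_group \<Rightarrow> 'a free_group" is inverse_word
  by (rule free_group_eq_inverse_word)

definition minus_free_group :: "'a free_group \<Rightarrow> 'a free_group \<Rightarrow> 'a free_group" where
  "minus_free_group u v = u + (- v)"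

instance
proof
  fix u v w :: "'a free_group"
  show "u + v + w = u + (v + w)"
    by transfer (simp add: free_group_eq.refl)
  show "0 + u = u"
    by transfer (simp add: free_group_eq.refl)
  show "u + 0 = u"
    by transfer (simp add: free_group_eq.refl)
  show "- u + u = 0"
    by transfer (rule inverse_word_append)
  show "u + - v = u - v"
    by (simp add: minus_free_group_def)
qed

end

type_synonym ('x, 'f) free_group_algebra = "'x free_group \<Rightarrow>\<^sub>0 'f"


section \<open>Recursive functions\<close>

text \<open>Kleene's general recursive functions: the functions obtained from the initial functions by
  composition, primitive recursion and minimization of regular functions.  All of them are total,
  and they are exactly the total computable functions.  An \<open>n\<close>-ary function is represented by a
  function on lists, of which only the values on lists of length \<open>n\<close> matter.\<close>

inductive recursive :: "nat \<Rightarrow> (nat list \<Rightarrow> nat) \<Rightarrow> bool" where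
  zero: "recursive n (\<lambda>xs. 0)"
| succ: "recursive 1 (\<lambda>xs. Suc (xs ! 0))"
| proj: "i < n \<Longrightarrow> recursive n (\<lambda>xs. xs ! i)"
| comp: "recursive (length gs) f \<Longrightarrow> \<forall>g\<in>set gs. recursive n g \<Longrightarrow>
    recursive n (\<lambda>xs. f (map (\<lambda>g. g xs) gs))"
| prim_rec: "recursive n f \<Longrightarrow> recursive (n + 2) g \<Longrightarrow>
    recursive (n + 1) (\<lambda>xs. rec_nat (f (tl xs)) (\<lambda>k r. g (k # r # tl xs)) (hd xs))"
| minimization: "recursive (n + 1) f \<Longrightarrow> \<forall>xs. length xs = n \<longrightarrow> (\<exists>y. f (y # xs) = 0) \<Longrightarrow>
    recursive n (\<lambda>xs. LEAST y. f (y # xs) = 0)"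

definition recursive_function :: "(nat \<Rightarrow> nat) \<Rightarrow> bool" where
  "recursive_function g \<longleftrightarrow> (\<exists>f. recursive 1 f \<and> (\<forall>n. g n = f [n]))"

end

theory Submission
  imports Defs "HOL-Library.Countable"
begin

text \<open>
  Let a deterministic two-stack machine be given, with configurations written as words containing
  exactly one state symbol.  Let \<open>B\<close> be generated by the stack letters, the halting state, and the
  differences \<open>u - v\<close> of the two sides of the rewriting rules \<open>u \<rightarrow> v\<close> of the machine.  If a
  configuration \<open>c\<close> reaches a halting configuration \<open>z\<close>, then \<open>c\<close> is in \<open>B\<close>, because \<open>c - c'\<close> is in
  \<open>B\<close> for every step from \<open>c\<close> to \<open>c'\<close>.  Conversely, the sum of the coefficients of all
  configurations that lead to \<open>z\<close> is a linear functional that takes the value \<open>1\<close> at \<open>c\<close>; by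
  determinism it vanishes on every product of generators other than the spelling of \<open>z\<close> letter by
  letter.  So \<open>c\<close> is not a combination of products with fewer factors than the length of \<open>z\<close>.
  For a universal machine, whose input consists of a program for a recursive function \<open>h\<close> and an
  argument \<open>k\<close>, the length of \<open>c\<close> is \<open>k\<close> plus a constant, while the length of \<open>z\<close> exceeds \<open>h k\<close>.
  All of this takes place in the submonoid generated by a code in two free letters.
\<close>

section \<open>Recursive functions and register programs\<close>

text \<open>Loops are tested after the body: \<open>Loop i c\<close> runs \<open>c\<close> at least
  once and repeats it until register \<open>i\<close> is \<open>0\<close>. The machine then needs a
  test only at the closing bracket and never has to skip a body.\<close>

datatype com = Skip | Inc nat | Dec nat | Seq com com (infixr \<open>;;\<close> 60) | Loop nat com

inductive eval :: "com \<Rightarrow> (nat \<Rightarrow> nat) \<Rightarrow> (nat \<Rightarrow> nat) \<Rightarrow> bool" where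
  Skip: "eval Skip s s"
| Inc: "eval (Inc i) s (s(i := Suc (s i)))"
| Dec: "eval (Dec i) s (s(i := s i - 1))"
| Seq: "eval c s t \<Longrightarrow> eval d t u \<Longrightarrow> eval (c ;; d) s u"
| Loop_exit: "eval c s t \<Longrightarrow> t i = 0 \<Longrightarrow> eval (Loop i c) s t"
| Loop_again: "eval c s t \<Longrightarrow> t i \<noteq> 0 \<Longrightarrow> eval (Loop i c) t u \<Longrightarrow> eval (Loop i c) s u"

lemma eval_Inc: "t = s(i := Suc (s i)) \<Longrightarrow> eval (Inc i) s t"
  by (simp add: eval.Inc)

lemma eval_Dec: "t = s(i := s i - 1) \<Longrightarrow> eval (Dec i) s t"
  by (metis eval.Dec)

section \<open>Clearing, moving and copying registers\<close>

definition clear :: "nat \<Rightarrow> com" where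
  "clear r = Loop r (Dec r)"

definition move :: "nat \<Rightarrow> nat \<Rightarrow> com" where
  "move r q = Loop r (Dec r ;; Inc q)"

text \<open>Reading a register destroys its contents, so the scratch register \<open>b\<close>
  receives a second copy from which \<open>r\<close> is restored.\<close>

definition copy :: "nat \<Rightarrow> nat \<Rightarrow> nat \<Rightarrow> com" where
  "copy r q b = Loop r (Dec r ;; Inc q ;; Inc b) ;; move b r"

lemma eval_clear: "t = s(r := 0) \<Longrightarrow> eval (clear r) s t"
proof (induction "s r" arbitrary: s)
  case 0
  then show ?case
    unfolding clear_def by (intro Loop_exit eval_Dec) auto
next
  case (Suc k)
  show ?case
  proof (cases k)
    case 0
    with Suc.hyps(2) Suc.prems show ?thesis
      unfolding clear_def by (intro Loop_exit eval_Dec) auto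
  next
    case (Suc j)
    have "eval (Loop r (Dec r)) (s(r := k)) t"
      using Suc.hyps(1)[of "s(r := k)"] Suc.prems by (simp add: clear_def)
    moreover have "eval (Dec r) s (s(r := k))"
      using Suc.hyps(2) by (intro eval_Dec) (metis diff_Suc_1)
    ultimately show ?thesis
      unfolding clear_def using Suc by (auto intro: Loop_again[of _ _ "s(r := k)"])
  qed
qed

text \<open>The body runs \<open>s r\<close> times. On an empty register the loop would still run
  once and add \<open>1\<close> to \<open>q\<close>, hence the hypothesis
  \<open>0 < s r\<close>.\<close>

lemma eval_move:
  assumes "r \<noteq> q" "0 < s r" "t = s(r := 0, q := s q + s r)"
  shows "eval (move r q) s t"
  using assms(2,3)
proof (induction "s r" arbitrary: s)
  case (Suc k)
  let ?s = "s(r := k, q := Suc (s q))"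
  have step: "eval (Dec r ;; Inc q) s ?s"
    by (rule eval.Seq[OF eval.Dec], rule eval_Inc) (simp add: assms(1) assms(1)[symmetric] flip: Suc.hyps(2))
  show ?case
  proof (cases k)
    case 0
    have "t = ?s"
      using Suc.prems assms(1) 0 by (auto simp flip: Suc.hyps(2))
    with step 0 assms(1) show ?thesis
      unfolding move_def by (intro Loop_exit) auto
  next
    case (Suc j)
    have "?s(r := 0, q := ?s q + ?s r) = t"
      using \<open>r \<noteq> q\<close> Suc.prems Suc.hyps(2)[symmetric] by auto
    then have "eval (move r q) ?s t"
      using \<open>r \<noteq> q\<close> Suc by (intro Suc.hyps(1)) auto
    with step show ?thesis
      unfolding move_def using Suc \<open>r \<noteq> q\<close> by - (rule Loop_again[OF step], auto)
  qed
qed simp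

lemma eval_copy:
  assumes "r \<noteq> q" "r \<noteq> b" "q \<noteq> b" "0 < s r" "s b = 0" "t = s(q := s q + s r)"
  shows "eval (copy r q b) s t"
proof -
  have "eval (Loop r (Dec r ;; Inc q ;; Inc b)) s (s(r := 0, q := s q + s r, b := s b + s r))"
    using \<open>0 < s r\<close>
  proof (induction "s r" arbitrary: s)
    case (Suc k)
    let ?s = "s(r := k, q := Suc (s q), b := Suc (s b))"
    have step: "eval (Dec r ;; Inc q ;; Inc b) s ?s"
      by (rule eval.Seq[OF eval.Dec], rule eval.Seq[OF eval.Inc], rule eval_Inc)
        (simp add: assms(1-3) assms(1-3)[symmetric] flip: Suc.hyps(2))
    show ?case
    proof (cases k)
      case 0
      have "s(r := 0, q := s q + s r, b := s b + s r) = ?s"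
        using assms(1-3) 0 by (auto simp flip: Suc.hyps(2))
      with step 0 assms(1-3) show ?thesis
        by (intro Loop_exit) auto
    next
      case (Suc j)
      have "?s(r := 0, q := ?s q + ?s r, b := ?s b + ?s r) = s(r := 0, q := s q + s r, b := s b + s r)"
        using assms(1-3) Suc.hyps(2)[symmetric] by auto
      then have "eval (Loop r (Dec r ;; Inc q ;; Inc b)) ?s (s(r := 0, q := s q + s r, b := s b + s r))"
        using Suc.hyps(1)[of ?s] assms(1-3) Suc by auto
      with step show ?thesis
        using Suc assms(1-3) by - (rule Loop_again[OF step], auto)
    qed
  qed simp
  moreover have "eval (move b r) (s(r := 0, q := s q + s r, b := s b + s r)) t"
    by (rule eval_move) (use assms in auto)
  ultimately show ?thesis
    unfolding copy_def by (rule eval.Seq)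
qed

text \<open>A register holding the value \<open>v\<close> of an argument or of a result contains \<open>Suc v\<close>. This makes
  loops that run at least once sufficient.\<close>

definition computes :: "com \<Rightarrow> nat list \<Rightarrow> nat \<Rightarrow> nat \<Rightarrow> (nat list \<Rightarrow> nat) \<Rightarrow> bool" where
  "computes c is b r f \<longleftrightarrow> (\<forall>s. (\<forall>k\<ge>b. s k = 0) \<longrightarrow> s r = 0 \<longrightarrow> (\<forall>i\<in>set is. 0 < s i) \<longrightarrow>
      eval c s (s(r := Suc (f (map (\<lambda>i. s i - 1) is)))))"

lemma computesI:
  assumes "\<And>s. \<lbrakk>\<forall>k\<ge>b. s k = 0; s r = 0; \<forall>i\<in>set is. 0 < s i\<rbrakk> \<Longrightarrow>
    eval c s (s(r := Suc (f (map (\<lambda>i. s i - 1) is))))"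
  shows "computes c is b r f"
  using assms by (simp add: computes_def)

lemma computesD:
  assumes "computes c is b r f" "\<forall>k\<ge>b. s k = 0" "s r = 0" "\<forall>i\<in>set is. 0 < s i"
    and "t = s(r := Suc (f (map (\<lambda>i. s i - 1) is)))"
  shows "eval c s t"
  using assms by (simp add: computes_def)

text \<open>The registers of the arguments and of the result and the bound \<open>b\<close> of the
  occupied registers are arbitrary, so that a subprogram can be placed wherever a larger program has
  room for it.\<close>

definition computable :: "nat \<Rightarrow> (nat list \<Rightarrow> nat) \<Rightarrow> bool" where
  "computable n f \<longleftrightarrow> (\<forall>is r b. length is = n \<longrightarrow> (\<forall>i\<in>set is. i < b) \<longrightarrow> r < b \<longrightarrow> r \<notin> set is \<longrightarrow>
    (\<exists>c. computes c is b r f))"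

lemma computableI:
  assumes "\<And>is r b. \<lbrakk>length is = n; \<forall>i\<in>set is. i < b; r < b; r \<notin> set is\<rbrakk> \<Longrightarrow> \<exists>c. computes c is b r f"
  shows "computable n f"
  using assms by (simp add: computable_def)

lemma computableE:
  assumes "computable n f" "length is = n" "\<forall>i\<in>set is. i < b" "r < b" "r \<notin> set is"
  obtains c where "computes c is b r f"
  using assms unfolding computable_def by blast

section \<open>Programs for the schemes that generate the recursive functions\<close>

lemma computable_zero: "computable n (\<lambda>xs. 0)"
proof (rule computableI)
  fix "is" and r b :: nat
  have "computes (Inc r) is b r (\<lambda>xs. 0)"
    by (rule computesI) (auto intro: eval_Inc)
  then show "\<exists>c. computes c is b r (\<lambda>xs. 0)"
    by blast
qed

lemma computable_succ: "computable 1 (\<lambda>xs. Suc (xs ! 0))"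
proof (rule computableI)
  fix "is" and r b :: nat
  assume *: "length is = 1" "\<forall>i\<in>set is. i < b" "r < b" "r \<notin> set is"
  obtain i where i: "is = [i]"
    using *(1) by (auto simp: length_Suc_conv)
  have "computes (copy i r b ;; Inc r) is b r (\<lambda>xs. Suc (xs ! 0))"
  proof (rule computesI)
    fix s :: "nat \<Rightarrow> nat"
    assume s: "\<forall>k\<ge>b. s k = 0" "s r = 0" "\<forall>i\<in>set is. 0 < s i"
    show "eval (copy i r b ;; Inc r) s (s(r := Suc (Suc (map (\<lambda>i. s i - 1) is ! 0))))"
      by (rule eval.Seq[OF eval_copy[where t = "s(r := s i)"] eval_Inc]) (use i * s in auto)
  qed
  then show "\<exists>c. computes c is b r (\<lambda>xs. Suc (xs ! 0))"
    by blast
qed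

lemma computable_proj:
  assumes "i < n"
  shows "computable n (\<lambda>xs. xs ! i)"
proof (rule computableI)
  fix "is" and r b :: nat
  assume *: "length is = n" "\<forall>i\<in>set is. i < b" "r < b" "r \<notin> set is"
  have i: "is ! i \<in> set is"
    using * assms by simp
  have "computes (copy (is ! i) r b) is b r (\<lambda>xs. xs ! i)"
  proof (rule computesI)
    fix s :: "nat \<Rightarrow> nat"
    assume s: "\<forall>k\<ge>b. s k = 0" "s r = 0" "\<forall>i\<in>set is. 0 < s i"
    have "is ! i \<noteq> r" "is ! i \<noteq> b" "0 < s (is ! i)"
      using i * s by auto
    then show "eval (copy (is ! i) r b) s (s(r := Suc (map (\<lambda>i. s i - 1) is ! i)))"
      by (intro eval_copy) (use * s assms in auto)
  qed
  then show "\<exists>c. computes c is b r (\<lambda>xs. xs ! i)"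
    by blast
qed

lemma eval_clear_range: "\<exists>c. \<forall>s. eval c s (\<lambda>k. if b \<le> k \<and> k < b + n then 0 else s k)"
proof (induction n)
  case 0
  show ?case
    by (rule exI[of _ Skip]) (simp add: eval.Skip flip: not_less)
next
  case (Suc n)
  then obtain c where c: "\<And>s. eval c s (\<lambda>k. if b \<le> k \<and> k < b + n then 0 else s k)"
    by blast
  have "eval (c ;; clear (b + n)) s (\<lambda>k. if b \<le> k \<and> k < b + Suc n then 0 else s k)" for s
    by (rule eval.Seq[OF c eval_clear]) (auto simp: fun_eq_iff)
  then show ?case
    by blast
qed

text \<open>The values of the functions in \<open>gs\<close> are stored one after the other from
  register \<open>b\<close> on. The program for the next function counts the registers filled so far
  as occupied, so its scratch space begins behind them.\<close>

lemma eval_arguments: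
  assumes "\<forall>g\<in>set gs. computable n g" "length is = n" "\<forall>i\<in>set is. i < b"
  shows "\<exists>c. \<forall>s. (\<forall>k\<ge>b. s k = 0) \<longrightarrow> (\<forall>i\<in>set is. 0 < s i) \<longrightarrow>
    eval c s (\<lambda>k. if b \<le> k \<and> k < b + length gs
      then Suc ((gs ! (k - b)) (map (\<lambda>i. s i - 1) is)) else s k)"
  using assms(1)
proof (induction gs rule: rev_induct)
  case Nil
  show ?case
    by (rule exI[of _ Skip]) (simp add: eval.Skip flip: not_less)
next
  case (snoc g gs)
  let ?t = "\<lambda>gs s k. if b \<le> k \<and> k < b + length gs
      then Suc ((gs ! (k - b)) (map (\<lambda>i. s i - 1) is)) else s k"
  obtain c where c: "\<And>s. \<lbrakk>\<forall>k\<ge>b. s k = 0; \<forall>i\<in>set is. 0 < s i\<rbrakk> \<Longrightarrow> eval c s (?t gs s)"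
    using snoc by auto
  have g: "computable n g"
    using snoc.prems by simp
  have bound: "\<forall>i\<in>set is. i < Suc (b + length gs)" "b + length gs \<notin> set is"
    using assms(3) by fastforce+
  obtain d where d: "computes d is (Suc (b + length gs)) (b + length gs) g"
    by (rule computableE[OF g assms(2) bound(1) lessI bound(2)])
  have "eval (c ;; d) s (?t (gs @ [g]) s)" if s: "\<forall>k\<ge>b. s k = 0" "\<forall>i\<in>set is. 0 < s i" for s
  proof (rule eval.Seq[OF c[OF s] computesD[OF d]])
    have eq: "map (\<lambda>i. ?t gs s i - 1) is = map (\<lambda>i. s i - 1) is"
      using assms(3) by auto
    show "?t (gs @ [g]) s = (?t gs s)(b + length gs := Suc (g (map (\<lambda>i. ?t gs s i - 1) is)))"
      unfolding eq by (auto simp: fun_eq_iff nth_append)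
  qed (use s assms(3) in auto)
  then show ?case
    by blast
qed

text \<open>The inner values are computed into the registers from \<open>b\<close> on,
  \<open>f\<close> is applied to them with scratch space beyond, and these registers are cleared at
  the end.\<close>

lemma computable_comp:
  assumes f: "computable (length gs) f" and gs: "\<forall>g\<in>set gs. computable n g"
  shows "computable n (\<lambda>xs. f (map (\<lambda>g. g xs) gs))"
proof (rule computableI)
  fix "is" and r b :: nat
  assume *: "length is = n" "\<forall>i\<in>set is. i < b" "r < b" "r \<notin> set is"
  let ?m = "length gs"
  let ?t = "\<lambda>s k. if b \<le> k \<and> k < b + ?m
      then Suc ((gs ! (k - b)) (map (\<lambda>i. s i - 1) is)) else s k"
  obtain c where c: "\<And>s. \<lbrakk>\<forall>k\<ge>b. s k = 0; \<forall>i\<in>set is. 0 < s i\<rbrakk> \<Longrightarrow> eval c s (?t s)"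
    using eval_arguments[OF gs *(1,2)] by blast
  have bound: "\<forall>i\<in>set [b..<b + ?m]. i < b + ?m" "r < b + ?m" "r \<notin> set [b..<b + ?m]"
    using * by auto
  obtain d where d: "computes d [b..<b + ?m] (b + ?m) r f"
    by (rule computableE[OF f _ bound]) simp
  obtain e where e: "\<And>s. eval e s (\<lambda>k. if b \<le> k \<and> k < b + ?m then 0 else s k)"
    using eval_clear_range by blast
  have "computes (c ;; d ;; e) is b r (\<lambda>xs. f (map (\<lambda>g. g xs) gs))"
  proof (rule computesI)
    fix s :: "nat \<Rightarrow> nat"
    assume s: "\<forall>k\<ge>b. s k = 0" "s r = 0" "\<forall>i\<in>set is. 0 < s i"
    let ?v = "Suc (f (map (\<lambda>g. g (map (\<lambda>i. s i - 1) is)) gs))"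
    have "map (\<lambda>i. ?t s i - 1) [b..<b + ?m] = map (\<lambda>g. g (map (\<lambda>i. s i - 1) is)) gs"
      by (rule nth_equalityI) auto
    then have "eval d (?t s) ((?t s)(r := ?v))"
      using s * by (intro computesD[OF d]) auto
    moreover have eq: "s(r := ?v) = (\<lambda>k. if b \<le> k \<and> k < b + ?m then 0 else ((?t s)(r := ?v)) k)"
      using s * by (auto simp: fun_eq_iff)
    ultimately show "eval (c ;; d ;; e) s (s(r := ?v))"
      unfolding eq by (intro eval.Seq[OF c[OF s(1,3)] eval.Seq[OF _ e]])
  qed
  then show "\<exists>c. computes c is b r (\<lambda>xs. f (map (\<lambda>g. g xs) gs))"
    by blast
qed

text \<open>The loop runs \<open>Suc x\<close> times for the recursion argument \<open>x\<close>; the output register lags one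
  iteration behind the accumulator \<open>b + 2\<close>, so that the superfluous last iteration is harmless.\<close>

lemma computable_prim_rec:
  assumes f: "computable n f" and g: "computable (n + 2) g"
  shows "computable (n + 1) (\<lambda>xs. rec_nat (f (tl xs)) (\<lambda>k r. g (k # r # tl xs)) (hd xs))"
proof (rule computableI)
  fix "is'" and r b :: nat
  assume *: "length is' = n + 1" "\<forall>i\<in>set is'. i < b" "r < b" "r \<notin> set is'"
  then obtain i "is" where is': "is' = i # is" and len: "length is = n"
    by (auto simp: length_Suc_conv)
  have bound: "\<forall>i\<in>set is. i < b + 3" "b + 2 \<notin> set is" "b + 2 < b + 3"
      "\<forall>i\<in>set ((b + 1) # r # is). i < b + 3" "b + 2 \<notin> set ((b + 1) # r # is)"
    using * is' by auto
  obtain c where c: "computes c is (b + 3) (b + 2) f"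
    by (rule computableE[OF f len bound(1,3,2)])
  obtain d where d: "computes d ((b + 1) # r # is) (b + 3) (b + 2) g"
    by (rule computableE[OF g _ bound(4,3,5)]) (simp add: len)
  define body where "body = Dec b ;; clear r ;; move (b + 2) r ;; d ;; Inc (b + 1)"
  define prog where "prog = copy i b (b + 1) ;; Inc (b + 1) ;; c ;; Loop b body ;;
    clear (b + 1) ;; clear (b + 2)"
  have "computes prog is' b r (\<lambda>xs. rec_nat (f (tl xs)) (\<lambda>k r. g (k # r # tl xs)) (hd xs))"
  proof (rule computesI)
    fix s :: "nat \<Rightarrow> nat"
    assume s: "\<forall>k\<ge>b. s k = 0" "s r = 0" "\<forall>i\<in>set is'. 0 < s i"
    define xs where "xs = map (\<lambda>i. s i - 1) is"
    define R where "R = rec_nat (f xs) (\<lambda>k r. g (k # r # xs))"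
    \<comment> \<open>The state at the head of the loop: \<open>m\<close> iterations remain,
      \<open>j\<close> is the recursion argument reached, the accumulator holds \<open>R j\<close>,
      and the output register holds some value \<open>v\<close> from before.\<close>
    define S where "S = (\<lambda>m j v. s(b := m, b + 1 := Suc j, b + 2 := Suc (R j), r := v))"
    have xs: "map (\<lambda>i. S m j v i - 1) is = xs" for m j v
      using * is' by (auto simp: S_def xs_def)
    have body: "eval body (S (Suc m) j v) (S m (Suc j) (Suc (R j)))" for m j v
    proof -
      let ?s1 = "S m j v" and ?s2 = "S m j 0"
      let ?s3 = "?s2(b + 2 := 0, r := Suc (R j))"
      let ?s4 = "?s3(b + 2 := Suc (R (Suc j)))"
      have "eval (Dec b) (S (Suc m) j v) ?s1"
        by (rule eval_Dec) (use * in \<open>auto simp: S_def fun_eq_iff\<close>)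
      moreover have "eval (clear r) ?s1 ?s2"
        by (rule eval_clear) (auto simp: S_def)
      moreover have "eval (move (b + 2) r) ?s2 ?s3"
        by (rule eval_move) (use * in \<open>auto simp: S_def fun_eq_iff\<close>)
      moreover have "eval d ?s3 ?s4"
      proof (rule computesD[OF d])
        have "map (\<lambda>i. ?s3 i - 1) ((b + 1) # r # is) = j # R j # xs"
          using * is' by (auto simp: S_def xs_def)
        then show "?s4 = ?s3(b + 2 := Suc (g (map (\<lambda>i. ?s3 i - 1) ((b + 1) # r # is))))"
          by (simp add: R_def)
      qed (use * is' s in \<open>auto simp: S_def\<close>)
      moreover have "eval (Inc (b + 1)) ?s4 (S m (Suc j) (Suc (R j)))"
        by (rule eval_Inc) (use * in \<open>auto simp: S_def fun_eq_iff\<close>)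
      ultimately show ?thesis
        unfolding body_def by - ((rule eval.Seq, assumption)+, assumption)
    qed
    have loop: "eval (Loop b body) (S (Suc m) j v) (S 0 (Suc (j + m)) (Suc (R (j + m))))" for m j v
    proof (induction m arbitrary: j v)
      case 0
      have "S 0 (Suc j) (Suc (R j)) b = 0"
        using * by (auto simp: S_def)
      then show ?case
        using Loop_exit[OF body[of 0 j v]] by simp
    next
      case (Suc m)
      have "S (Suc m) (Suc j) (Suc (R j)) b \<noteq> 0"
        using * by (auto simp: S_def)
      then show ?case
        using Loop_again[OF body[of "Suc m" j v] _ Suc[of "Suc j" "Suc (R j)"]] by simp
    qed
    have "0 < s i"
      using s is' by simp
    let ?s1 = "s(b := s i)"
    let ?s2 = "?s1(b + 1 := 1)"
    have "eval (copy i b (b + 1)) s ?s1"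
      by (rule eval_copy) (use * is' s in auto)
    moreover have "eval (Inc (b + 1)) ?s1 ?s2"
      by (rule eval_Inc) (use s in auto)
    moreover have "eval c ?s2 (S (s i) 0 0)"
    proof (rule computesD[OF c])
      have "map (\<lambda>i. ?s2 i - 1) is = xs"
        using * is' by (auto simp: xs_def)
      then show "S (s i) 0 0 = ?s2(b + 2 := Suc (f (map (\<lambda>i. ?s2 i - 1) is)))"
        using s(2) * by (auto simp: S_def R_def fun_eq_iff)
    qed (use * is' s in auto)
    moreover have "eval (Loop b body) (S (s i) 0 0) (S 0 (s i) (Suc (R (s i - 1))))"
      using loop[of "s i - 1" 0 0] \<open>0 < s i\<close> by simp
    moreover have "eval (clear (b + 1)) (S 0 (s i) (Suc (R (s i - 1))))
        ((S 0 (s i) (Suc (R (s i - 1))))(b + 1 := 0))"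
      by (rule eval_clear) simp
    moreover have "eval (clear (b + 2)) ((S 0 (s i) (Suc (R (s i - 1))))(b + 1 := 0))
        (s(r := Suc (R (s i - 1))))"
      by (rule eval_clear) (use s * in \<open>auto simp: S_def fun_eq_iff\<close>)
    ultimately have "eval prog s (s(r := Suc (R (s i - 1))))"
      unfolding prog_def by - ((rule eval.Seq, assumption)+, assumption)
    then show "eval prog s (s(r := Suc (rec_nat (f (tl (map (\<lambda>i. s i - 1) is')))
        (\<lambda>k r. g (k # r # tl (map (\<lambda>i. s i - 1) is'))) (hd (map (\<lambda>i. s i - 1) is')))))"
      by (simp add: is' R_def xs_def)
  qed
  then show "\<exists>c. computes c is' b r (\<lambda>xs. rec_nat (f (tl xs)) (\<lambda>k r. g (k # r # tl xs)) (hd xs))"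
    by blast
qed

text \<open>The candidate \<open>y\<close> is kept in register \<open>b\<close>. After
  \<open>Dec\<close>, register \<open>b + 1\<close> holds \<open>f (y # xs)\<close> itself without
  the shift, so the loop stops exactly at a zero. By then the candidate has been increased once too
  often, which the last \<open>Dec b\<close> undoes.\<close>

lemma computable_minimization:
  assumes f: "computable (n + 1) f" and regular: "\<forall>xs. length xs = n \<longrightarrow> (\<exists>y. f (y # xs) = 0)"
  shows "computable n (\<lambda>xs. LEAST y. f (y # xs) = 0)"
proof (rule computableI)
  fix "is" and r b :: nat
  assume *: "length is = n" "\<forall>i\<in>set is. i < b" "r < b" "r \<notin> set is"
  have bound: "\<forall>i\<in>set (b # is). i < b + 2" "b + 1 < b + 2" "b + 1 \<notin> set (b # is)"
    using * by auto
  obtain c where c: "computes c (b # is) (b + 2) (b + 1) f"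
    by (rule computableE[OF f _ bound]) (simp add: *)
  define body where "body = clear (b + 1) ;; c ;; Dec (b + 1) ;; Inc b"
  have "computes (Inc b ;; Loop (b + 1) body ;; Dec b ;; move b r) is b r
      (\<lambda>xs. LEAST y. f (y # xs) = 0)"
  proof (rule computesI)
    fix s :: "nat \<Rightarrow> nat"
    assume s: "\<forall>k\<ge>b. s k = 0" "s r = 0" "\<forall>i\<in>set is. 0 < s i"
    define xs where "xs = map (\<lambda>i. s i - 1) is"
    define Y where "Y = (LEAST y. f (y # xs) = 0)"
    have "\<exists>y. f (y # xs) = 0"
      using regular * by (simp add: xs_def)
    then have Y: "f (Y # xs) = 0"
      unfolding Y_def by (rule LeastI_ex)
    define T where "T = (\<lambda>y t. s(b := Suc y, b + 1 := t))"
    have body: "eval body (T y t) (T (Suc y) (f (y # xs)))" for y t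
    proof -
      have "eval (clear (b + 1)) (T y t) (T y 0)"
        by (rule eval_clear) (auto simp: T_def)
      moreover have "eval c (T y 0) (T y (Suc (f (y # xs))))"
      proof (rule computesD[OF c])
        have "map (\<lambda>i. T y 0 i - 1) (b # is) = y # xs"
          using * by (auto simp: T_def xs_def)
        then show "T y (Suc (f (y # xs))) =
            (T y 0)(b + 1 := Suc (f (map (\<lambda>i. T y 0 i - 1) (b # is))))"
          by (simp add: T_def)
      qed (use * s in \<open>auto simp: T_def\<close>)
      moreover have "eval (Dec (b + 1)) (T y (Suc (f (y # xs)))) (T y (f (y # xs)))"
        by (rule eval_Dec) (auto simp: T_def)
      moreover have "eval (Inc b) (T y (f (y # xs))) (T (Suc y) (f (y # xs)))"
        by (rule eval_Inc) (auto simp: T_def fun_eq_iff)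
      ultimately show ?thesis
        unfolding body_def by - ((rule eval.Seq, assumption)+, assumption)
    qed
    \<comment> \<open>Induction on the distance \<open>m\<close> of the candidate from the least
      zero \<open>Y\<close>.\<close>
    have loop: "eval (Loop (b + 1) body) (T (Y - m) t) (T (Suc Y) 0)" if "m \<le> Y" for m t
      using that
    proof (induction m arbitrary: t)
      case 0
      have "T (Suc Y) 0 (b + 1) = 0"
        by (simp add: T_def)
      then show ?case
        using Loop_exit[OF body[of Y t, unfolded Y]] by simp
    next
      case (Suc m)
      let ?y = "Y - Suc m"
      have y: "Suc ?y = Y - m"
        using Suc.prems by linarith
      have "?y < (LEAST y. f (y # xs) = 0)"
        using Suc.prems unfolding Y_def[symmetric] by linarith
      then have "f (?y # xs) \<noteq> 0"
        by (rule not_less_Least)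
      then have "T (Y - m) (f (?y # xs)) (b + 1) \<noteq> 0"
        by (simp add: T_def)
      moreover have "eval body (T ?y t) (T (Y - m) (f (?y # xs)))"
        using body[of ?y t] unfolding y .
      moreover have "m \<le> Y"
        using Suc.prems by simp
      ultimately show ?case
        using Loop_again Suc.IH by metis
    qed
    have "eval (Inc b) s (T 0 0)"
      by (rule eval_Inc) (use s in \<open>auto simp: T_def fun_eq_iff\<close>)
    moreover have "eval (Loop (b + 1) body) (T 0 0) (T (Suc Y) 0)"
      using loop[of Y] by simp
    moreover have "eval (Dec b) (T (Suc Y) 0) (T Y 0)"
      by (rule eval_Dec) (auto simp: T_def fun_eq_iff)
    moreover have "eval (move b r) (T Y 0) (s(r := Suc Y))"
      by (rule eval_move) (use s * in \<open>auto simp: T_def fun_eq_iff\<close>)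
    ultimately show "eval (Inc b ;; Loop (b + 1) body ;; Dec b ;; move b r) s
        (s(r := Suc (LEAST y. f (y # map (\<lambda>i. s i - 1) is) = 0)))"
      unfolding Y_def xs_def by - ((rule eval.Seq, assumption)+, assumption)
  qed
  then show "\<exists>c. computes c is b r (\<lambda>xs. LEAST y. f (y # xs) = 0)"
    by blast
qed

lemma recursive_imp_computable: "recursive n f \<Longrightarrow> computable n f"
proof (induction rule: recursive.induct)
  case (comp gs f n)
  then show ?case
    by (intro computable_comp) auto
qed (auto intro: computable_zero computable_succ computable_proj computable_prim_rec
    computable_minimization simp del: One_nat_def)

corollary recursive_function_eval:
  assumes "recursive_function h"
  obtains c where "\<And>k. \<exists>t. eval c ((\<lambda>_. 0)(0 := Suc k)) t \<and> t 1 = Suc (h k)"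
proof -
  obtain f where f: "recursive 1 f" "\<And>n. h n = f [n]"
    using assms by (auto simp: recursive_function_def)
  obtain c where c: "computes c [0] 2 1 f"
    by (rule computableE[OF recursive_imp_computable[OF f(1)], of "[0]" 2 1]) auto
  have "eval c ((\<lambda>_. 0)(0 := Suc k)) (((\<lambda>_. 0)(0 := Suc k))(1 := Suc (h k)))" for k
    by (rule computesD[OF c]) (auto simp: f(2))
  then show ?thesis
    by (intro that[of c]) (metis fun_upd_same)
qed

section \<open>A universal two-stack machine\<close>

datatype letter = Cell | Cur | One | Bar | LeftEnd | Mv | Reset | Plus | Minus | Open | Opened
  | Close | Stop | Mark

datatype state = Fetch | GoMv | GoReset | FindCell | GoPlus | GoMinus | DoMinus | GoTest | DoTest
  | Return | BackReturn | Back | ExitReturn | Exit | Halt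

instance letter :: finite
proof
  have "UNIV = {Cell, Cur, One, Bar, LeftEnd, Mv, Reset, Plus, Minus, Open, Opened, Close, Stop, Mark}"
    using letter.exhaust by auto
  then show "finite (UNIV :: letter set)"
    by (metis finite.emptyI finite_insert)
qed

instance state :: finite
proof
  have "UNIV = {Fetch, GoMv, GoReset, FindCell, GoPlus, GoMinus, DoMinus, GoTest, DoTest, Return,
      BackReturn, Back, ExitReturn, Exit, Halt}"
    using state.exhaust by auto
  then show "finite (UNIV :: state set)"
    by (metis finite.emptyI finite_insert)
qed

text \<open>On the tape, the register contents in unary (each block introduced by \<open>Cell\<close>, the current one
  by \<open>Cur\<close>) are followed by the program text. The state \<open>Fetch\<close> stands in front of the next
  instruction; when the head leaves for the registers, \<open>Mark\<close> keeps its place. A loop that is being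
  executed has its bracket changed to \<open>Opened\<close>, so the bracket that matches a \<open>Close\<close> is always the
  nearest \<open>Opened\<close> to the left.\<close>

definition pops_left :: "state \<Rightarrow> bool" where
  "pops_left q \<longleftrightarrow> q \<in> {GoMv, GoReset, GoPlus, GoMinus, GoTest, Back, Exit}"

text \<open>In \<open>delta q x = (u, q', v)\<close> the letter \<open>x\<close> popped from the
  stack that \<open>q\<close> reads is replaced by \<open>u\<close> on top of the left and
  \<open>v\<close> on top of the right stack. The states \<open>GoMv\<close> to
  \<open>GoTest\<close> look for the registers; the three return states look for \<open>Mark\<close>
  and remember what to do there. \<open>Stop\<close> falls under the default clause of
  \<open>Fetch\<close>.\<close>

fun delta :: "state \<Rightarrow> letter \<Rightarrow> letter list \<times> state \<times> letter list" where
  "delta Fetch Mv = ([Mv], GoMv, [Mark])"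
| "delta Fetch Reset = ([Reset], GoReset, [Mark])"
| "delta Fetch Plus = ([Plus], GoPlus, [Mark])"
| "delta Fetch Minus = ([Minus], GoMinus, [Mark])"
| "delta Fetch Open = ([Opened], Fetch, [])"
| "delta Fetch Close = ([Close], GoTest, [Mark])"
| "delta Fetch x = ([x], Halt, [])"
| "delta GoMv x = (if x = Cur then ([Cell], FindCell, []) else ([], GoMv, [x]))"
| "delta GoReset x = (if x = LeftEnd then ([LeftEnd], FindCell, [])
    else ([], GoReset, [if x = Cur then Cell else x]))"
| "delta FindCell x = (if x = Cell then ([Cur], Return, []) else ([x], FindCell, []))"
| "delta GoPlus x = (if x = Cur then ([One, Cur], Return, []) else ([], GoPlus, [x]))"
| "delta GoMinus x = (if x = Cur then ([Cur], DoMinus, []) else ([], GoMinus, [x]))"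
| "delta DoMinus x = ([], Return, if x = One then [] else [x])"
| "delta GoTest x = (if x = Cur then ([Cur], DoTest, []) else ([], GoTest, [x]))"
| "delta DoTest x = ([], if x = One then BackReturn else ExitReturn, [x])"
| "delta Return x = (if x = Mark then ([], Fetch, []) else ([x], Return, []))"
| "delta BackReturn x = (if x = Mark then ([], Back, []) else ([x], BackReturn, []))"
| "delta Back x = (if x = Opened then ([Opened], Fetch, []) else ([], Back, [x]))"
| "delta ExitReturn x = (if x = Mark then ([], Exit, [Mark]) else ([x], ExitReturn, []))"
| "delta Exit x = (if x = Opened then ([], Return, [Open]) else ([], Exit, [x]))"
| "delta Halt x = ([], Halt, [])"

type_synonym config = "letter list \<times> state \<times> letter list"

text \<open>A configuration consists of the left stack, the state and the right stack; both stacks are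
  listed from the top, so the left one is read backwards in the word of the configuration.\<close>

inductive step :: "config \<Rightarrow> config \<Rightarrow> bool" where
  right: "\<lbrakk>q \<noteq> Halt; \<not> pops_left q; delta q x = (u, q', v)\<rbrakk> \<Longrightarrow> step (l, q, x # r) (u @ l, q', v @ r)"
| left: "\<lbrakk>q \<noteq> Halt; pops_left q; delta q x = (u, q', v)\<rbrakk> \<Longrightarrow> step (x # l, q, r) (u @ l, q', v @ r)"

abbreviation steps :: "config \<Rightarrow> config \<Rightarrow> bool" where
  "steps \<equiv> step\<^sup>*\<^sup>*"

text \<open>The state alone decides which stack is read, and \<open>delta\<close> is a
  function.\<close>

lemma step_deterministic: "step c d \<Longrightarrow> step c d' \<Longrightarrow> d = d'"
  by (auto elim!: step.cases)

lemma no_step_Halt: "\<not> step (l, Halt, r) c"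
  by (auto elim: step.cases)

text \<open>The rest of the run, to an arbitrary \<open>c\<close>, is a hypothesis. Long runs are
  thus assembled backwards from their last phase, and \<open>c\<close> can be left open until the
  program has been treated as a whole.\<close>

lemma steps_right:
  assumes "q \<noteq> Halt" "\<not> pops_left q" "delta q x = (u, q', v)" "steps (u @ l, q', v @ r) c"
  shows "steps (l, q, x # r) c"
  by (rule converse_rtranclp_into_rtranclp[OF step.right[OF assms(1-3)] assms(4)])

lemma steps_left:
  assumes "q \<noteq> Halt" "pops_left q" "delta q x = (u, q', v)" "steps (u @ l, q', v @ r) c"
  shows "steps (x # l, q, r) c"
  by (rule converse_rtranclp_into_rtranclp[OF step.left[OF assms(1-3)] assms(4)])

lemma walk_right:
  assumes "q \<noteq> Halt" "\<not> pops_left q" "\<And>x. x \<in> set w \<Longrightarrow> delta q x = ([x], q, [])"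
    and "steps (rev w @ l, q, r) c"
  shows "steps (l, q, w @ r) c"
  using assms(3,4)
proof (induction w arbitrary: l)
  case (Cons x w)
  then show ?case
    by (auto intro!: steps_right[OF assms(1,2)])
qed simp

lemma walk_left:
  assumes "q \<noteq> Halt" "pops_left q" "\<And>x. x \<in> set w \<Longrightarrow> delta q x = ([], q, [x])"
    and "steps (l, q, w @ r) c"
  shows "steps (rev w @ l, q, r) c"
  using assms(3,4)
proof (induction w arbitrary: r rule: rev_induct)
  case (snoc x w)
  then show ?case
    by (auto intro!: steps_left[OF assms(1,2)])
qed simp

section \<open>Register contents on the tape\<close>

definition cells :: "(nat \<Rightarrow> nat) \<Rightarrow> nat \<Rightarrow> nat \<Rightarrow> letter list" where
  "cells s i j = concat (map (\<lambda>k. Cell # replicate (s k) One) [i..<j])"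

definition tape :: "nat \<Rightarrow> nat \<Rightarrow> (nat \<Rightarrow> nat) \<Rightarrow> letter list" where
  "tape N p s = LeftEnd # cells s 0 p @ Cur # replicate (s p) One @ cells s (Suc p) N @ [Bar]"

text \<open>These words can be crossed on the way between the program text and the registers: they
  contain none of the letters at which these journeys end.\<close>

definition plain :: "letter list \<Rightarrow> bool" where
  "plain w \<longleftrightarrow> Cur \<notin> set w \<and> Mark \<notin> set w \<and> LeftEnd \<notin> set w"

lemma plain_simps [simp]:
  "plain []"
  "plain (x # w) \<longleftrightarrow> x \<noteq> Cur \<and> x \<noteq> Mark \<and> x \<noteq> LeftEnd \<and> plain w"
  "plain (u @ w) \<longleftrightarrow> plain u \<and> plain w"
  "plain (replicate n One)" "plain (replicate n Mv)"
  by (auto simp: plain_def)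

lemma set_cells: "set (cells s i j) \<subseteq> {Cell, One}"
  by (auto simp: cells_def)

lemma plain_cells [simp]: "plain (cells s i j)"
  using set_cells by (fastforce simp: plain_def)

lemma cells_cong: "(\<And>k. i \<le> k \<Longrightarrow> k < j \<Longrightarrow> s k = t k) \<Longrightarrow> cells s i j = cells t i j"
  unfolding cells_def by (intro arg_cong[where f = concat] map_cong) auto

lemma cells_Cons: "i < j \<Longrightarrow> cells s i j = Cell # replicate (s i) One @ cells s (Suc i) j"
  by (simp add: cells_def upt_conv_Cons)

lemma cells_append: "i \<le> j \<Longrightarrow> j \<le> k \<Longrightarrow> cells s i j @ cells s j k = cells s i k"
  unfolding cells_def
  by (metis concat_append le_Suc_ex map_append upt_add_eq_append)

lemma cells_snoc: "i \<le> j \<Longrightarrow> cells s i (Suc j) = cells s i j @ Cell # replicate (s j) One"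
  by (simp add: cells_def)

section \<open>Execution of single instructions\<close>

lemma steps_Return:
  assumes "plain w" "steps (rev w @ l, Fetch, r) c"
  shows "steps (l, Return, w @ Mark # r) c"
  using assms by (intro walk_right) (auto simp: pops_left_def plain_def intro!: steps_right)

text \<open>\<open>Cur\<close> turns into \<open>Cell\<close>, and the next \<open>Cell\<close> to
  the right turns into \<open>Cur\<close>; by \<open>Suc p < N\<close> it is the one of register
  \<open>Suc p\<close>.\<close>

lemma steps_Mv:
  assumes "Suc p < N" "plain u" "steps (rev (tape N (Suc p) s @ u @ [Mv]), Fetch, r) c"
  shows "steps (rev (tape N p s @ u), Fetch, Mv # r) c"
proof -
  let ?a = "LeftEnd # cells s 0 p" and ?o = "replicate (s p) One"
  let ?d = "replicate (s (Suc p)) One @ cells s (Suc (Suc p)) N @ Bar # u @ [Mv]"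
  have tp: "tape N p s @ u @ [Mv] = ?a @ Cur # ?o @ Cell # ?d"
    using assms(1) by (simp add: tape_def cells_Cons[of "Suc p"])
  have tp': "tape N (Suc p) s @ u @ [Mv] = ?a @ Cell # ?o @ Cur # ?d"
    by (simp add: tape_def cells_snoc)
  have "steps (rev (?a @ Cell # ?o @ Cur # ?d), Fetch, r) c"
    using assms(3) unfolding tp' .
  then have "steps (rev (?a @ Cell # ?o @ [Cur]), Return, ?d @ Mark # r) c"
    using assms(2) by (intro steps_Return) auto
  then have "steps (rev ?o @ Cell # rev ?a, FindCell, Cell # ?d @ Mark # r) c"
    by (auto intro!: steps_right simp: pops_left_def)
  then have "steps (Cell # rev ?a, FindCell, ?o @ Cell # ?d @ Mark # r) c"
    by (intro walk_right) (auto simp: pops_left_def)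
  then have "steps (Cur # rev ?a, GoMv, (?o @ Cell # ?d) @ Mark # r) c"
    by (auto intro!: steps_left simp: pops_left_def)
  then have "steps (rev (?o @ Cell # ?d) @ Cur # rev ?a, GoMv, Mark # r) c"
    using assms(2) set_cells[of s "Suc (Suc p)" N]
    by (intro walk_left) (auto simp: pops_left_def plain_def)
  then have "steps (rev (tape N p s @ u @ [Mv]), GoMv, Mark # r) c"
    unfolding tp by simp
  then show ?thesis
    by (intro steps_right[where q' = GoMv]) (auto simp: pops_left_def)
qed

text \<open>On the way left to \<open>LeftEnd\<close> the letter \<open>Cur\<close> becomes an
  ordinary \<open>Cell\<close>; then the first \<open>Cell\<close> to the right, that of register
  \<open>0\<close>, becomes \<open>Cur\<close>.\<close>

lemma steps_Reset:
  assumes "p < N" "plain u" "steps (rev (tape N 0 s @ u @ [Reset]), Fetch, r) c"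
  shows "steps (rev (tape N p s @ u), Fetch, Reset # r) c"
proof -
  let ?b = "replicate (s p) One @ cells s (Suc p) N @ Bar # u @ [Reset]"
  let ?d = "replicate (s 0) One @ cells s 1 N @ Bar # u @ [Reset]"
  have tp: "tape N p s @ u @ [Reset] = LeftEnd # cells s 0 p @ Cur # ?b"
    by (simp add: tape_def)
  \<comment> \<open>Once \<open>Cur\<close> has been turned into \<open>Cell\<close>, the blocks
    form the single list \<open>cells s 0 N\<close>, which is split again at register
    \<open>0\<close>.\<close>
  have "cells s 0 p @ Cell # replicate (s p) One @ cells s (Suc p) N = cells s 0 N"
    using assms(1) cells_append[of 0 p N s] by (simp add: cells_Cons)
  also have "\<dots> = Cell # replicate (s 0) One @ cells s 1 N"
    using assms(1) by (simp add: cells_Cons)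
  finally have cells: "cells s 0 p @ Cell # ?b = Cell # ?d"
    by simp
  have tp': "tape N 0 s @ u @ [Reset] = LeftEnd # Cur # ?d"
    by (simp add: tape_def cells_def)
  have "steps (rev (LeftEnd # Cur # ?d), Fetch, r) c"
    using assms(3) unfolding tp' .
  then have "steps ([Cur, LeftEnd], Return, ?d @ Mark # r) c"
    using assms(2) by (intro steps_Return) auto
  then have "steps ([LeftEnd], FindCell, Cell # ?d @ Mark # r) c"
    by (auto intro!: steps_right simp: pops_left_def)
  then have "steps ([LeftEnd], GoReset, (Cell # ?d) @ Mark # r) c"
    by (auto intro!: steps_left simp: pops_left_def)
  then have "steps ([LeftEnd], GoReset, cells s 0 p @ Cell # ?b @ Mark # r) c"
    unfolding cells[symmetric] by simp
  then have "steps (rev (cells s 0 p) @ [LeftEnd], GoReset, Cell # ?b @ Mark # r) c"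
    using set_cells[of s 0 p] by (intro walk_left) (auto simp: pops_left_def)
  then have "steps (Cur # rev (cells s 0 p) @ [LeftEnd], GoReset, ?b @ Mark # r) c"
    by (auto intro!: steps_left simp: pops_left_def)
  then have "steps (rev ?b @ Cur # rev (cells s 0 p) @ [LeftEnd], GoReset, Mark # r) c"
    using assms(2) set_cells[of s "Suc p" N]
    by (intro walk_left) (auto simp: pops_left_def plain_def)
  then have "steps (rev (tape N p s @ u @ [Reset]), GoReset, Mark # r) c"
    unfolding tp by simp
  then show ?thesis
    by (intro steps_right[where q' = GoReset]) (auto simp: pops_left_def)
qed

text \<open>A register is reached from register \<open>0\<close> by single moves, so one finite
  alphabet serves programs with any number of registers.\<close>

definition address :: "nat \<Rightarrow> letter list" where
  "address i = Reset # replicate i Mv"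

lemma steps_address:
  assumes "p < N" "i < N" "plain u" "steps (rev (tape N i s @ u @ address i), Fetch, r) c"
  shows "steps (rev (tape N p s @ u), Fetch, address i @ r) c"
proof -
  have Mvs: "steps (rev (tape N 0 s @ v), Fetch, replicate i Mv @ r) c"
    if "i < N" "plain v" "steps (rev (tape N i s @ v @ replicate i Mv), Fetch, r) c" for v r
    using that
  proof (induction i arbitrary: r)
    case (Suc i)
    have "steps (rev (tape N i s @ v @ replicate i Mv), Fetch, Mv # r) c"
      using steps_Mv[of i N "v @ replicate i Mv"] Suc.prems
      by (simp flip: replicate_append_same)
    then show ?case
      using Suc.IH[of "Mv # r"] Suc.prems by (simp add: replicate_app_Cons_same)
  qed simp
  have "steps (rev (tape N 0 s @ u @ [Reset]), Fetch, replicate i Mv @ r) c"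
    by (rule Mvs) (use assms in \<open>simp_all add: address_def\<close>)
  then show ?thesis
    using steps_Reset[OF assms(1,3)] by (simp add: address_def)
qed

lemma tape_upd:
  "tape N p (s(p := n)) = (LeftEnd # cells s 0 p) @ Cur # replicate n One @ cells s (Suc p) N @ [Bar]"
proof -
  have "cells (s(p := n)) 0 p = cells s 0 p" "cells (s(p := n)) (Suc p) N = cells s (Suc p) N"
    by (rule cells_cong; simp)+
  then show ?thesis
    by (simp add: tape_def)
qed

lemma steps_Go:
  assumes "pops_left q" "q \<noteq> Halt" "\<And>x. x \<noteq> Cur \<Longrightarrow> delta q x = ([], q, [x])" "plain v"
    and "steps (Cur # a, q, v @ Mark # r) c"
  shows "steps (rev v @ Cur # a, q, Mark # r) c"
proof (rule walk_left[OF assms(2,1)])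
  show "delta q x = ([], q, [x])" if "x \<in> set v" for x
    using assms(3)[of x] assms(4) that by (auto simp: plain_def)
qed (rule assms(5))

lemma steps_Plus:
  assumes "plain u" "steps (rev (tape N p (s(p := Suc (s p))) @ u @ [Plus]), Fetch, r) c"
  shows "steps (rev (tape N p s @ u), Fetch, Plus # r) c"
proof -
  let ?a = "rev (LeftEnd # cells s 0 p)"
  let ?v = "replicate (s p) One @ cells s (Suc p) N @ Bar # u @ [Plus]"
  have "steps (rev ?v @ One # Cur # ?a, Fetch, r) c"
    using assms(2) unfolding tape_upd by (simp add: replicate_app_Cons_same)
  then have "steps (One # Cur # ?a, Return, ?v @ Mark # r) c"
    using assms(1) by (intro steps_Return) auto
  then have "steps (Cur # ?a, GoPlus, ?v @ Mark # r) c"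
    by (auto intro!: steps_left simp: pops_left_def)
  then have "steps (rev ?v @ Cur # ?a, GoPlus, Mark # r) c"
    using assms(1) by (intro steps_Go) (auto simp: pops_left_def)
  then show ?thesis
    by (intro steps_right[where q' = GoPlus]) (auto simp: pops_left_def tape_def)
qed

lemma steps_Minus:
  assumes "plain u" "steps (rev (tape N p (s(p := s p - 1)) @ u @ [Minus]), Fetch, r) c"
  shows "steps (rev (tape N p s @ u), Fetch, Minus # r) c"
proof -
  let ?a = "rev (LeftEnd # cells s 0 p)"
  let ?w = "cells s (Suc p) N @ Bar # u @ [Minus]"
  let ?v = "\<lambda>n. replicate n One @ ?w"
  have "steps (rev (?v (s p - 1)) @ Cur # ?a, Fetch, r) c"
    using assms(2) unfolding tape_upd by simp
  then have *: "steps (Cur # ?a, Return, ?v (s p - 1) @ Mark # r) c"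
    using assms(1) by (intro steps_Return) auto
  have "steps (Cur # ?a, DoMinus, ?v (s p) @ Mark # r) c"
  proof (cases "s p")
    case 0
    \<comment> \<open>An empty block is followed by \<open>Cell\<close> or \<open>Bar\<close>, which
      \<open>DoMinus\<close> puts back, in accordance with truncated subtraction.\<close>
    obtain x w where "?w = x # w" "x \<noteq> One"
      by (cases "Suc p < N") (auto simp: cells_Cons, auto simp: cells_def)
    with * 0 show ?thesis
      by (auto intro!: steps_right simp: pops_left_def)
  next
    case (Suc n)
    with * show ?thesis
      by (auto intro!: steps_right simp: pops_left_def)
  qed
  then have "steps (Cur # ?a, GoMinus, ?v (s p) @ Mark # r) c"
    by (auto intro!: steps_left simp: pops_left_def)
  then have "steps (rev (?v (s p)) @ Cur # ?a, GoMinus, Mark # r) c"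
    using assms(1) by (intro steps_Go) (auto simp: pops_left_def)
  then show ?thesis
    by (intro steps_right[where q' = GoMinus]) (auto simp: pops_left_def tape_def)
qed

text \<open>Since \<open>w\<close> contains no \<open>Opened\<close>, the search to the left ends at
  the bracket of this loop. The text passed on the way back lies on the right stack again, ready for
  the next iteration.\<close>

lemma steps_Close_again:
  assumes "s p \<noteq> 0" "plain u" "plain w" "Opened \<notin> set w"
    and "steps (rev (tape N p s @ u @ [Opened]), Fetch, w @ Close # r) c"
  shows "steps (rev (tape N p s @ u @ Opened # w), Fetch, Close # r) c"
proof -
  let ?a = "rev (LeftEnd # cells s 0 p)"
  let ?v = "replicate (s p) One @ cells s (Suc p) N @ Bar # u @ Opened # w @ [Close]"
  have "steps (Opened # rev (tape N p s @ u), Back, (w @ [Close]) @ r) c"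
    using assms(5) by (auto intro!: steps_left simp: pops_left_def)
  then have "steps (rev (w @ [Close]) @ Opened # rev (tape N p s @ u), Back, r) c"
    using assms(4) by (intro walk_left) (auto simp: pops_left_def)
  then have "steps (rev ?v @ Cur # ?a, Back, r) c"
    by (simp add: tape_def)
  then have "steps (rev ?v @ Cur # ?a, BackReturn, Mark # r) c"
    by (auto intro!: steps_right simp: pops_left_def)
  then have "steps (Cur # ?a, BackReturn, ?v @ Mark # r) c"
    using assms(2,3) set_cells[of s "Suc p" N]
    by (intro walk_right) (auto simp: pops_left_def plain_def)
  then have "steps (Cur # ?a, DoTest, ?v @ Mark # r) c"
    using assms(1) by (cases "s p") (auto intro!: steps_right simp: pops_left_def)
  then have "steps (Cur # ?a, GoTest, ?v @ Mark # r) c"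
    by (auto intro!: steps_left simp: pops_left_def)
  then have "steps (rev ?v @ Cur # ?a, GoTest, Mark # r) c"
    using assms(2,3) by (intro steps_Go) (auto simp: pops_left_def)
  then show ?thesis
    by (intro steps_right[where q' = GoTest]) (auto simp: pops_left_def tape_def)
qed

text \<open>The bracket becomes \<open>Open\<close> again, so the text of a finished loop is what it
  was before: an enclosing loop can execute it anew and finds its own \<open>Opened\<close> beyond
  it. \<open>Mark\<close> stays in place during the search and shows where to resume.\<close>

lemma steps_Close_exit:
  assumes "s p = 0" "plain u" "plain w" "Opened \<notin> set w"
    and "steps (rev (tape N p s @ u @ Open # w @ [Close]), Fetch, r) c"
  shows "steps (rev (tape N p s @ u @ Opened # w), Fetch, Close # r) c"
proof -
  let ?a = "rev (LeftEnd # cells s 0 p)"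
  let ?v = "cells s (Suc p) N @ Bar # u @ Opened # w @ [Close]"
  have "steps (rev (tape N p s @ u), Return, (Open # w @ [Close]) @ Mark # r) c"
    using assms(3,5) by (intro steps_Return) auto
  then have "steps (Opened # rev (tape N p s @ u), Exit, (w @ [Close]) @ Mark # r) c"
    by (auto intro!: steps_left simp: pops_left_def)
  then have "steps (rev (w @ [Close]) @ Opened # rev (tape N p s @ u), Exit, Mark # r) c"
    using assms(4) by (intro walk_left) (auto simp: pops_left_def)
  then have "steps (rev ?v @ Cur # ?a, Exit, Mark # r) c"
    using assms(1) by (simp add: tape_def)
  then have "steps (rev ?v @ Cur # ?a, ExitReturn, Mark # r) c"
    by (auto intro!: steps_right simp: pops_left_def)
  then have *: "steps (Cur # ?a, ExitReturn, ?v @ Mark # r) c"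
    using assms(2,3) set_cells[of s "Suc p" N]
    by (intro walk_right) (auto simp: pops_left_def plain_def)
  obtain x v where "?v = x # v" "x \<noteq> One"
    by (cases "Suc p < N") (auto simp: cells_Cons, auto simp: cells_def)
  with * have "steps (Cur # ?a, DoTest, ?v @ Mark # r) c"
    by (auto intro!: steps_right simp: pops_left_def)
  then have "steps (Cur # ?a, GoTest, ?v @ Mark # r) c"
    by (auto intro!: steps_left simp: pops_left_def)
  then have "steps (rev ?v @ Cur # ?a, GoTest, Mark # r) c"
    using assms(2,3) by (intro steps_Go) (auto simp: pops_left_def)
  then show ?thesis
    using assms(1) by (intro steps_right[where q' = GoTest]) (auto simp: pops_left_def tape_def)
qed

section \<open>Compilation of programs and its correctness\<close>

fun code :: "com \<Rightarrow> letter list" where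
  "code Skip = []"
| "code (Inc i) = address i @ [Plus]"
| "code (Dec i) = address i @ [Minus]"
| "code (c ;; d) = code c @ code d"
| "code (Loop i c) = Open # code c @ address i @ [Close]"

fun registers :: "com \<Rightarrow> nat set" where
  "registers Skip = {}"
| "registers (Inc i) = {i}"
| "registers (Dec i) = {i}"
| "registers (c ;; d) = registers c \<union> registers d"
| "registers (Loop i c) = insert i (registers c)"

lemma finite_registers: "finite (registers c)"
  by (induction c) auto

lemma plain_address [simp]: "plain (address i)"
  by (simp add: address_def)

lemma Opened_notin_address: "Opened \<notin> set (address i)"
  by (auto simp: address_def)

lemma plain_code [simp]: "plain (code c)"
  by (induction c) auto

lemma Opened_notin_code: "Opened \<notin> set (code c)"
  by (induction c) (auto simp: Opened_notin_address)

text \<open>The executed text \<open>u\<close> and the remaining text \<open>r\<close> are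
  arbitrary, so that pieces of code can be concatenated. The position \<open>p'\<close> of the
  current register at the end depends on neither of them.\<close>

definition simulates :: "nat \<Rightarrow> letter list \<Rightarrow> (nat \<Rightarrow> nat) \<Rightarrow> (nat \<Rightarrow> nat) \<Rightarrow> bool" where
  "simulates N w s t \<longleftrightarrow> (\<forall>p<N. \<exists>p'<N. \<forall>u r c. plain u \<longrightarrow>
    steps (rev (tape N p' t @ u @ w), Fetch, r) c \<longrightarrow> steps (rev (tape N p s @ u), Fetch, w @ r) c)"

lemma simulatesI:
  assumes "i < N" "\<And>p u r c. p < N \<Longrightarrow> plain u \<Longrightarrow>
    steps (rev (tape N i t @ u @ w), Fetch, r) c \<Longrightarrow> steps (rev (tape N p s @ u), Fetch, w @ r) c"
  shows "simulates N w s t"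
  unfolding simulates_def using assms by blast

lemma simulates_append:
  assumes v: "simulates N v s t" "plain v" and w: "simulates N w t t'"
  shows "simulates N (v @ w) s t'"
  unfolding simulates_def
proof (intro allI impI)
  fix p assume "p < N"
  with v obtain p1 where p1: "p1 < N" "\<And>u r c. plain u \<Longrightarrow>
      steps (rev (tape N p1 t @ u @ v), Fetch, r) c \<Longrightarrow> steps (rev (tape N p s @ u), Fetch, v @ r) c"
    unfolding simulates_def by blast
  obtain p2 where p2: "p2 < N" "\<And>u r c. plain u \<Longrightarrow>
      steps (rev (tape N p2 t' @ u @ w), Fetch, r) c \<Longrightarrow> steps (rev (tape N p1 t @ u), Fetch, w @ r) c"
    using w p1(1) unfolding simulates_def by blast
  have "steps (rev (tape N p s @ u), Fetch, (v @ w) @ r) c"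
    if "plain u" "steps (rev (tape N p2 t' @ u @ v @ w), Fetch, r) c" for u r c
    using p1(2)[of u "w @ r"] p2(2)[of "u @ v" r] that v(2) by simp
  with p2(1) show "\<exists>p'<N. \<forall>u r c. plain u \<longrightarrow>
      steps (rev (tape N p' t' @ u @ v @ w), Fetch, r) c \<longrightarrow>
      steps (rev (tape N p s @ u), Fetch, (v @ w) @ r) c"
    by blast
qed

lemma simulates_Inc:
  assumes "i < N"
  shows "simulates N (address i @ [Plus]) s (s(i := Suc (s i)))"
proof (rule simulatesI[OF assms])
  fix p u r c
  assume "p < N" and u: "plain u"
    and "steps (rev (tape N i (s(i := Suc (s i))) @ u @ address i @ [Plus]), Fetch, r) c"
  then have "steps (rev (tape N i s @ u @ address i), Fetch, Plus # r) c"
    using steps_Plus[of "u @ address i"] by simp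
  then show "steps (rev (tape N p s @ u), Fetch, (address i @ [Plus]) @ r) c"
    using steps_address[OF \<open>p < N\<close> assms u] by simp
qed

lemma simulates_Dec:
  assumes "i < N"
  shows "simulates N (address i @ [Minus]) s (s(i := s i - 1))"
proof (rule simulatesI[OF assms])
  fix p u r c
  assume "p < N" and u: "plain u"
    and "steps (rev (tape N i (s(i := s i - 1)) @ u @ address i @ [Minus]), Fetch, r) c"
  then have "steps (rev (tape N i s @ u @ address i), Fetch, Minus # r) c"
    using steps_Minus[of "u @ address i"] by simp
  then show "steps (rev (tape N p s @ u), Fetch, (address i @ [Minus]) @ r) c"
    using steps_address[OF \<open>p < N\<close> assms u] by simp
qed

text \<open>The loop is simulated from the first letter after its opened bracket.\<close>

definition simulates_loop :: "nat \<Rightarrow> nat \<Rightarrow> letter list \<Rightarrow> (nat \<Rightarrow> nat) \<Rightarrow> (nat \<Rightarrow> nat) \<Rightarrow> bool" where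
  "simulates_loop N i w s t \<longleftrightarrow> (\<forall>p u r c. p < N \<longrightarrow> plain u \<longrightarrow>
    steps (rev (tape N i t @ u @ Open # w @ address i @ [Close]), Fetch, r) c \<longrightarrow>
    steps (rev (tape N p s @ u @ [Opened]), Fetch, w @ address i @ Close # r) c)"

lemma simulates_loop_exit:
  assumes w: "simulates N w s t" "plain w" "Opened \<notin> set w" and i: "i < N" "t i = 0"
  shows "simulates_loop N i w s t"
  unfolding simulates_loop_def
proof (intro allI impI)
  fix p u r c
  assume "p < N" and u: "plain u"
    and c: "steps (rev (tape N i t @ u @ Open # w @ address i @ [Close]), Fetch, r) c"
  then obtain p' where p': "p' < N" "\<And>u r c. plain u \<Longrightarrow>
      steps (rev (tape N p' t @ u @ w), Fetch, r) c \<Longrightarrow> steps (rev (tape N p s @ u), Fetch, w @ r) c"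
    using w(1) unfolding simulates_def by blast
  \<comment> \<open>Between the bracket and \<open>Close\<close> stand the body and the address of
    the register to be tested, since \<open>Close\<close> tests the current register.\<close>
  have "steps (rev (tape N i t @ u @ Opened # (w @ address i)), Fetch, Close # r) c"
    by (rule steps_Close_exit) (use u c w i in \<open>simp_all add: Opened_notin_address\<close>)
  then have "steps (rev (tape N p' t @ u @ Opened # w), Fetch, address i @ Close # r) c"
    using u w(2) by (intro steps_address[OF p'(1) i(1)]) simp_all
  then show "steps (rev (tape N p s @ u @ [Opened]), Fetch, w @ address i @ Close # r) c"
    using p'(2)[of "u @ [Opened]"] u by simp
qed

lemma simulates_loop_again:
  assumes w: "simulates N w s t" "plain w" "Opened \<notin> set w" and i: "i < N" "t i \<noteq> 0"
    and again: "simulates_loop N i w t t'"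
  shows "simulates_loop N i w s t'"
  unfolding simulates_loop_def
proof (intro allI impI)
  fix p u r c
  assume "p < N" and u: "plain u"
    and c: "steps (rev (tape N i t' @ u @ Open # w @ address i @ [Close]), Fetch, r) c"
  then obtain p' where p': "p' < N" "\<And>u r c. plain u \<Longrightarrow>
      steps (rev (tape N p' t @ u @ w), Fetch, r) c \<Longrightarrow> steps (rev (tape N p s @ u), Fetch, w @ r) c"
    using w(1) unfolding simulates_def by blast
  have "steps (rev (tape N i t @ u @ [Opened]), Fetch, w @ address i @ Close # r) c"
    using again u c i(1) unfolding simulates_loop_def by blast
  then have "steps (rev (tape N i t @ u @ Opened # (w @ address i)), Fetch, Close # r) c"
    by (intro steps_Close_again) (use u w i in \<open>simp_all add: Opened_notin_address\<close>)
  then have "steps (rev (tape N p' t @ u @ Opened # w), Fetch, address i @ Close # r) c"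
    using u w(2) by (intro steps_address[OF p'(1) i(1)]) simp_all
  then show "steps (rev (tape N p s @ u @ [Opened]), Fetch, w @ address i @ Close # r) c"
    using p'(2)[of "u @ [Opened]"] u by simp
qed

lemma simulates_Loop:
  assumes "simulates_loop N i w s t" "i < N"
  shows "simulates N (Open # w @ address i @ [Close]) s t"
proof (rule simulatesI[OF assms(2)])
  fix p u r c
  assume "p < N" "plain u" "steps (rev (tape N i t @ u @ Open # w @ address i @ [Close]), Fetch, r) c"
  then have "steps (rev (tape N p s @ u @ [Opened]), Fetch, w @ address i @ Close # r) c"
    using assms(1) unfolding simulates_loop_def by blast
  then show "steps (rev (tape N p s @ u), Fetch, (Open # w @ address i @ [Close]) @ r) c"
    by (auto intro!: steps_right simp: pops_left_def)
qed

text \<open>The second conjunct serves the case \<open>Loop_again\<close>: the repetition starts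
  behind a bracket that is already \<open>Opened\<close>, whereas \<open>simulates\<close> starts in
  front of \<open>Open\<close>.\<close>

lemma simulates_code:
  assumes "eval c s t" "registers c \<subseteq> {..<N}"
  shows "simulates N (code c) s t \<and> (\<forall>i b. c = Loop i b \<longrightarrow> simulates_loop N i (code b) s t)"
  using assms
proof (induction rule: eval.induct)
  case (Skip s)
  then show ?case
    by (auto simp: simulates_def)
next
  case (Inc i s)
  then show ?case
    unfolding code.simps by (intro conjI simulates_Inc allI impI) simp_all
next
  case (Dec i s)
  then show ?case
    unfolding code.simps by (intro conjI simulates_Dec allI impI) simp_all
next
  case (Seq c s t d u)
  then show ?case
    using simulates_append[of N "code c" s t "code d" u] by simp
next
  case (Loop_exit c s t i)
  then have "simulates_loop N i (code c) s t"
    by (intro simulates_loop_exit) (auto simp: Opened_notin_code)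
  then show ?case
    using simulates_Loop Loop_exit.prems by simp
next
  case (Loop_again c s t i u)
  then have "simulates_loop N i (code c) s u"
    by (intro simulates_loop_again[of N _ s t]) (auto simp: Opened_notin_code)
  then show ?case
    using simulates_Loop Loop_again.prems by simp
qed

lemma code_correct:
  assumes "eval c s t" "registers c \<subseteq> {..<N}" "p < N"
  shows "\<exists>p'<N. steps (rev (tape N p s), Fetch, code c @ [Stop]) (Stop # rev (tape N p' t @ code c), Halt, [])"
proof -
  have "simulates N (code c) s t"
    using simulates_code[OF assms(1,2)] by blast
  then obtain p' where p': "p' < N" "\<And>u r d. \<lbrakk>plain u; steps (rev (tape N p' t @ u @ code c), Fetch, r) d\<rbrakk>
      \<Longrightarrow> steps (rev (tape N p s @ u), Fetch, code c @ r) d"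
    using assms(3) unfolding simulates_def by blast
  have "steps (rev (tape N p' t @ [] @ code c), Fetch, [Stop]) (Stop # rev (tape N p' t @ code c), Halt, [])"
    by (auto intro!: steps_right simp: pops_left_def)
  then show ?thesis
    using p'(1) p'(2)[of "[]" "[Stop]"] by auto
qed

section \<open>Lengths of tapes and configurations\<close>

lemma length_cells: "length (cells s i j) = (\<Sum>k=i..<j. Suc (s k))"
  by (simp add: cells_def length_concat comp_def interv_sum_list_conv_sum_set_nat)

lemma length_tape:
  assumes "p < N"
  shows "length (tape N p s) = (\<Sum>k<N. Suc (s k)) + 2"
proof -
  have "(\<Sum>k<N. Suc (s k)) = (\<Sum>k=0..<p. Suc (s k)) + (\<Sum>k=p..<N. Suc (s k))"
    using assms by (simp add: sum.atLeastLessThan_concat lessThan_atLeast0)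
  also have "(\<Sum>k=p..<N. Suc (s k)) = Suc (s p) + (\<Sum>k=Suc p..<N. Suc (s k))"
    using assms by (rule sum.atLeast_Suc_lessThan)
  finally show ?thesis
    by (simp add: tape_def length_cells)
qed

definition config_length :: "config \<Rightarrow> nat" where
  "config_length = (\<lambda>(l, q, r). length l + 1 + length r)"

text \<open>The argument enters the initial configuration only as \<open>Suc k\<close> letters
  \<open>One\<close>, and the result stands in unary on the final tape.\<close>

theorem recursive_function_steps:
  assumes "recursive_function h"
  shows "\<exists>C. \<forall>k. \<exists>c l r. config_length c = C + k \<and> steps c (l, Halt, r) \<and>
    h k < config_length (l, Halt, r)"
proof -
  obtain c where c: "\<And>k. \<exists>t. eval c ((\<lambda>_. 0)(0 := Suc k)) t \<and> t 1 = Suc (h k)"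
    using recursive_function_eval[OF assms] by blast
  obtain n where n: "registers c \<subseteq> {..<n}"
    using finite_registers[of c] by (auto simp: finite_nat_set_iff_bounded)
  \<comment> \<open>There must be room for register \<open>0\<close> with the argument and register
    \<open>1\<close> with the result, even if the program does not mention them.\<close>
  define N where "N = Suc (Suc n)"
  have N: "registers c \<subseteq> {..<N}" "0 < N"
    using n by (auto simp: N_def)
  \<comment> \<open>The \<open>5\<close> counts \<open>LeftEnd\<close>, \<open>Bar\<close>, the
    state, \<open>Stop\<close> and the shift of the argument from \<open>k\<close> to
    \<open>Suc k\<close>.\<close>
  have "\<exists>d l r. config_length d = N + length (code c) + 5 + k \<and> steps d (l, Halt, r) \<and>
      h k < config_length (l, Halt, r)" for k
  proof -
    obtain t where t: "eval c ((\<lambda>_. 0)(0 := Suc k)) t" "t 1 = Suc (h k)"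
      using c by blast
    obtain p where p: "p < N" "steps (rev (tape N 0 ((\<lambda>_. 0)(0 := Suc k))), Fetch, code c @ [Stop])
        (Stop # rev (tape N p t @ code c), Halt, [])"
      using code_correct[OF t(1) N] by blast
    have "Suc (t 1) \<le> (\<Sum>k<N. Suc (t k))"
      by (rule member_le_sum[of 1 "{..<N}" "\<lambda>k. Suc (t k)"]) (auto simp: N_def)
    then have "h k < config_length (Stop # rev (tape N p t @ code c), Halt, [])"
      using t(2) by (simp add: config_length_def length_tape[OF p(1)])
    moreover have "(\<Sum>j<N. Suc (((\<lambda>_. 0)(0 := Suc k)) j)) = N + Suc k"
      by (simp only: N_def sum.lessThan_Suc_shift[of _ "Suc n"]) simp
    then have "config_length (rev (tape N 0 ((\<lambda>_. 0)(0 := Suc k))), Fetch, code c @ [Stop]) =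
        N + length (code c) + 5 + k"
      by (simp only: config_length_def prod.case length_rev length_tape[OF N(2)]) simp
    ultimately show ?thesis
      using p(2) by blast
  qed
  then show ?thesis
    by blast
qed

section \<open>Filtrations and distortion functions\<close>

context unital_algebra
begin

lemma subalgebra_hull: "subalgebra (subalgebra hull Y)"
  by (rule hull_in) (auto simp: subalgebra_def subspace_def)

lemma subspace_filtration: "subspace (filtration Y n)"
  by (simp add: filtration_def)

lemma prod_list_in_filtration:
  "set ys \<subseteq> Y \<Longrightarrow> length ys \<le> n \<Longrightarrow> prod_list ys \<in> filtration Y n"
  unfolding filtration_def by (rule span_base) auto

lemma filtration_subset:
  assumes "subspace V" "\<And>ys. set ys \<subseteq> Y \<Longrightarrow> length ys \<le> n \<Longrightarrow> prod_list ys \<in> V"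
  shows "filtration Y n \<subseteq> V"
  unfolding filtration_def by (rule span_minimal) (use assms in auto)

lemma filtration_mono: "m \<le> n \<Longrightarrow> filtration Y m \<subseteq> filtration Y n"
  by (rule filtration_subset[OF subspace_filtration]) (auto intro: prod_list_in_filtration)

lemma mult_in_filtration:
  assumes "x \<in> filtration Y m" "y \<in> filtration Y n"
  shows "x * y \<in> filtration Y (m + n)"
proof -
  have "filtration Y m \<subseteq> {x. x * y \<in> filtration Y (m + n)}"
  proof (rule filtration_subset)
    show "subspace {x. x * y \<in> filtration Y (m + n)}"
      using subspace_filtration[of Y "m + n"]
      by (auto simp: subspace_def distrib_right scale_mult_left)
    fix us assume us: "set us \<subseteq> Y" "length us \<le> m"
    have "filtration Y n \<subseteq> {y. prod_list us * y \<in> filtration Y (m + n)}"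
    proof (rule filtration_subset)
      show "subspace {y. prod_list us * y \<in> filtration Y (m + n)}"
        using subspace_filtration[of Y "m + n"]
        by (auto simp: subspace_def distrib_left scale_mult_right)
      fix vs assume "set vs \<subseteq> Y" "length vs \<le> n"
      then show "prod_list vs \<in> {y. prod_list us * y \<in> filtration Y (m + n)}"
        using us prod_list_in_filtration[of "us @ vs" Y "m + n"] by simp
    qed
    with assms(2) show "prod_list us \<in> {x. x * y \<in> filtration Y (m + n)}"
      by auto
  qed
  with assms(1) show ?thesis
    by auto
qed

lemma prod_list_in_filtration_mult:
  assumes "set ys \<subseteq> filtration Y k"
  shows "prod_list ys \<in> filtration Y (k * length ys)"
  using assms
proof (induction ys)
  case Nil
  show ?case
    using prod_list_in_filtration[of "[]"] by simp
next
  case (Cons y ys)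
  then show ?case
    using mult_in_filtration[of y Y k "prod_list ys" "k * length ys"] by simp
qed

lemma filtration_rescale:
  assumes "Z \<subseteq> filtration Y k"
  shows "filtration Z n \<subseteq> filtration Y (k * n)"
proof (rule filtration_subset[OF subspace_filtration])
  fix zs assume "set zs \<subseteq> Z" "length zs \<le> n"
  then show "prod_list zs \<in> filtration Y (k * n)"
    using assms prod_list_in_filtration_mult[of zs Y k] filtration_mono[of "k * length zs" "k * n" Y]
    by auto
qed

lemma hull_eq_UN_filtration: "subalgebra hull Y = (\<Union>n. filtration Y n)"
proof -
  define U where "U = (\<Union>n. filtration Y n)"
  have U: "x \<in> U \<longleftrightarrow> (\<exists>n. x \<in> filtration Y n)" for x
    by (simp add: U_def)
  have "subalgebra hull Y = U"
  proof (rule hull_unique)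
    show "Y \<subseteq> U"
    proof
      fix y assume "y \<in> Y"
      then have "y \<in> filtration Y 1"
        using prod_list_in_filtration[of "[y]" Y 1] by simp
      then show "y \<in> U"
        unfolding U by (rule exI)
    qed
    have "x + y \<in> U" if xy: "x \<in> U" "y \<in> U" for x y
    proof -
      obtain i j where ij: "x \<in> filtration Y i" "y \<in> filtration Y j"
        using xy U by auto
      then have "x + y \<in> filtration Y (max i j)"
        using filtration_mono[of i "max i j" Y] filtration_mono[of j "max i j" Y]
        by (intro subspace_add[OF subspace_filtration]) auto
      then show ?thesis
        unfolding U by (rule exI)
    qed
    moreover have "x * y \<in> U" if xy: "x \<in> U" "y \<in> U" for x y
    proof -
      obtain i j where "x \<in> filtration Y i" "y \<in> filtration Y j"
        using xy U by auto
      then have "x * y \<in> filtration Y (i + j)"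
        by (rule mult_in_filtration)
      then show ?thesis
        unfolding U by (rule exI)
    qed
    moreover have "c *s x \<in> U" if "x \<in> U" for c x
      using that subspace_scale[OF subspace_filtration] unfolding U by metis
    moreover have "0 \<in> U"
      using subspace_0[OF subspace_filtration] unfolding U by metis
    moreover have "1 \<in> U"
      using prod_list_in_filtration[of "[]" Y 0] by (auto simp: U)
    ultimately show "subalgebra U"
      by (simp add: subalgebra_def subspace_def)
    fix B assume B: "Y \<subseteq> B" "subalgebra B"
    have prod: "prod_list ys \<in> B" if "set ys \<subseteq> Y" for ys
      using that B by (induction ys) (auto simp: subalgebra_def)
    have "filtration Y n \<subseteq> B" for n
      using B(2) prod by (intro filtration_subset) (simp_all add: subalgebra_def)
    then show "U \<subseteq> B"
      by (auto simp: U_def)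
  qed
  then show ?thesis
    by (simp add: U_def)
qed

lemma finite_subset_filtration:
  assumes "finite S" "S \<subseteq> subalgebra hull Y"
  obtains k where "S \<subseteq> filtration Y k"
proof -
  have "\<forall>x\<in>S. \<exists>n. x \<in> filtration Y n"
    using assms(2) by (auto simp: hull_eq_UN_filtration)
  then obtain f where f: "\<forall>x\<in>S. x \<in> filtration Y (f x)"
    by metis
  have "S \<subseteq> filtration Y (Max (f ` S))"
    using f filtration_mono[OF Max_ge] assms(1) by blast
  then show ?thesis
    by (rule that)
qed

text \<open>As \<open>filtration Y n\<close> has finite dimension, a basis of
  \<open>B \<inter> filtration Y n\<close> is finite and lies in one stage of the filtration of
  \<open>B\<close>. Hence the \<open>LEAST\<close> in \<open>distortion_function\<close> is
  attained.\<close>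

lemma intersection_subset_filtration:
  assumes "finite_generating_set A Y" "finite_generating_set B Z"
  shows "\<exists>m. B \<inter> filtration Y n \<subseteq> filtration Z m"
proof -
  obtain S where S: "S \<subseteq> B \<inter> filtration Y n" "independent S" "B \<inter> filtration Y n \<subseteq> span S"
    by (rule maximal_independent_subset)
  have "finite {prod_list ys | ys. set ys \<subseteq> Y \<and> length ys \<le> n}"
    using finite_lists_length_le[of Y n] assms(1) by (simp add: finite_generating_set_def setcompr_eq_image)
  then have "finite S"
    by (rule independent_span_bound[THEN conjunct1]) (use S in \<open>auto simp: filtration_def\<close>)
  then obtain m where "S \<subseteq> filtration Z m"
    by (rule finite_subset_filtration) (use S assms(2) in \<open>auto simp: finite_generating_set_def\<close>)
  then show ?thesis
    using S(3) span_minimal[OF _ subspace_filtration] by blast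
qed

end

section \<open>Some closure properties of recursive functions\<close>

lemma recursive_function_comp:
  assumes "recursive_function f" "recursive_function g"
  shows "recursive_function (\<lambda>n. f (g n))"
proof -
  obtain f' g' where f': "recursive 1 f'" "\<forall>n. f n = f' [n]" and g': "recursive 1 g'" "\<forall>n. g n = g' [n]"
    using assms by (auto simp: recursive_function_def)
  have "recursive 1 (\<lambda>xs. f' (map (\<lambda>g. g xs) [g']))"
    by (rule recursive.comp) (use f' g' in auto)
  then show ?thesis
    using f'(2) g'(2) unfolding recursive_function_def by fastforce
qed

lemma recursive_function_Suc: "recursive_function Suc"
  unfolding recursive_function_def using recursive.succ by fastforce

text \<open>The step function in the primitive recursion for multiplication by \<open>a\<close>;
  \<open>xs ! 1\<close> is the value accumulated so far.\<close>

lemma recursive_add_const: "recursive 2 (\<lambda>xs. xs ! 1 + a)"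
proof (induction a)
  case 0
  show ?case
    using recursive.proj[of 1 2] by (simp del: One_nat_def)
next
  case (Suc a)
  have "recursive 2 (\<lambda>xs. Suc (map (\<lambda>g. g xs) [\<lambda>xs. xs ! 1 + a] ! 0))"
    by (rule recursive.comp[where f = "\<lambda>xs. Suc (xs ! 0)"])
      (use Suc recursive.succ in \<open>simp_all del: One_nat_def\<close>, simp)
  then show ?case
    by simp
qed

lemma recursive_function_times: "recursive_function (\<lambda>n. a * n)"
proof -
  have "recursive (0 + 1) (\<lambda>xs. rec_nat 0 (\<lambda>k r. (k # r # tl xs) ! 1 + a) (hd xs))"
    by (rule recursive.prim_rec[OF recursive.zero]) (use recursive_add_const[of a] in \<open>simp add: numeral_2_eq_2\<close>)
  moreover have "a * n = rec_nat 0 (\<lambda>k r. r + a) n" for n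
    by (induction n) auto
  ultimately show ?thesis
    unfolding recursive_function_def by (intro exI conjI allI) auto
qed

text \<open>An undistorted subalgebra would satisfy the inclusion with the recursive function
  \<open>t * n\<close>, and a distortion function bounded by a recursive \<open>g\<close> would give
  it with \<open>g\<close>.\<close>

lemma (in unital_algebra) unbounded_distortion:
  assumes B: "\<And>Y Z g. finite_generating_set UNIV Y \<Longrightarrow> finite_generating_set B Z \<Longrightarrow>
    recursive_function g \<Longrightarrow> \<exists>n. \<not> B \<inter> filtration Y n \<subseteq> filtration Z (g n)"
  shows "distorted UNIV B"
    and "distortion_function UNIV B d \<Longrightarrow> \<not> (\<exists>g. recursive_function g \<and> (\<forall>n. d n \<le> g n))"
proof -
  show "distorted UNIV B"
    unfolding distorted_def undistorted_def using B recursive_function_times by blast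
  assume "distortion_function UNIV B d"
  then obtain Y Z where YZ: "finite_generating_set UNIV Y" "finite_generating_set B Z"
    and d: "d = (\<lambda>n. LEAST m. B \<inter> filtration Y n \<subseteq> filtration Z m)"
    by (auto simp: distortion_function_def)
  have "B \<inter> filtration Y n \<subseteq> filtration Z (d n)" for n
    unfolding d by (rule LeastI_ex) (rule intersection_subset_filtration[OF YZ])
  then show "\<not> (\<exists>g. recursive_function g \<and> (\<forall>n. d n \<le> g n))"
    using B[OF YZ] filtration_mono[of "d _" _ Z] by blast
qed

text \<open>The linear functional that is \<open>1\<close> on the basis elements in \<open>T\<close>
  and \<open>0\<close> on the others.\<close>

definition coeff_sum :: "'m set \<Rightarrow> ('m \<Rightarrow>\<^sub>0 'f::field) \<Rightarrow> 'f" where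
  "coeff_sum T p = (\<Sum>m \<in> Poly_Mapping.keys p \<inter> T. Poly_Mapping.lookup p m)"

lemma coeff_sum_superset:
  assumes "finite K" "Poly_Mapping.keys p \<subseteq> K"
  shows "coeff_sum T p = (\<Sum>m \<in> K \<inter> T. Poly_Mapping.lookup p m)"
  unfolding coeff_sum_def using assms
  by (intro sum.mono_neutral_left) (auto simp: in_keys_iff)

lemma coeff_sum_add: "coeff_sum T (p + q) = coeff_sum T p + coeff_sum T q"
  using Poly_Mapping.keys_add[of p q]
  by (simp add: coeff_sum_superset[of "Poly_Mapping.keys p \<union> Poly_Mapping.keys q"] lookup_add sum.distrib)

lemma coeff_sum_scale: "coeff_sum T (scale c p) = c * coeff_sum T (p :: 'm::monoid_add \<Rightarrow>\<^sub>0 'f::field)"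
proof -
  have "Poly_Mapping.keys (scale c p) \<subseteq> Poly_Mapping.keys p"
    by (auto simp: in_keys_iff)
  then show ?thesis
    by (simp add: coeff_sum_superset[of "Poly_Mapping.keys p"] sum_distrib_left)
qed

lemma coeff_sum_single: "coeff_sum T (Poly_Mapping.single m c) = (if m \<in> T then c else 0)"
  by (simp add: coeff_sum_superset[of "{m}"])

lemma coeff_sum_diff: "coeff_sum T (p - q) = coeff_sum T p - coeff_sum T q"
  using coeff_sum_add[of T "p - q" q] by simp

lemma subspace_coeff_sum_eq_0:
  "monoid_algebra.subspace {p :: 'm::monoid_add \<Rightarrow>\<^sub>0 'f::field. coeff_sum T p = 0}"
  by (rule monoid_algebra.subspaceI) (simp_all add: coeff_sum_add coeff_sum_scale, simp add: coeff_sum_def)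

section \<open>The subalgebra of a machine\<close>

type_synonym symbol = "state + letter"

fun word :: "config \<Rightarrow> symbol list" where
  "word (l, q, r) = map Inr (rev l) @ Inl q # map Inr r"

lemma word_inject [simp]: "word c = word d \<longleftrightarrow> c = d"
proof
  have "u = v \<and> q = q' \<and> r = r'"
    if "map Inr u @ Inl q # map Inr r = (map Inr v @ Inl q' # map Inr r' :: symbol list)" for u v q q' r r'
    using that
  proof (induction u arbitrary: v)
    case Nil
    then show ?case
      by (cases v) (auto dest: injD[OF inj_mapI[OF inj_Inr]])
  next
    case (Cons x u)
    then show ?case
      by (cases v) auto
  qed
  moreover assume "word c = word d"
  ultimately show "c = d"
    by (cases c, cases d) fastforce
qed simp

lemma length_word: "length (word c) = config_length c"
  by (cases c) (simp add: config_length_def)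

definition heads :: "symbol list \<Rightarrow> nat" where
  "heads w = length (filter isl w)"

lemma heads_append [simp]: "heads (u @ v) = heads u + heads v"
  by (simp add: heads_def)

lemma heads_map_Inr [simp]: "heads (map Inr w) = 0"
  by (simp add: heads_def)

lemma heads_word [simp]: "heads (word c) = 1"
  by (cases c) (simp add: heads_def)

text \<open>A step touches only the tops of the stacks, so material may be added at their
  bottoms.\<close>

lemma step_context:
  assumes "step (l, q, r) (l', q', r')"
  shows "step (l @ a, q, r @ b) (l' @ a, q', r' @ b)"
  using assms
proof cases
  case (right x u v r)
  then show ?thesis
    using step.right[of q x u q' v "l @ a" "r @ b"] by simp
next
  case (left x u v l)
  then show ?thesis
    using step.left[of q x u q' v "l @ a" "r @ b"] by simp
qed

text \<open>An embedding of the free monoid of words over the machine symbols. Injectivity keeps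
  distinct words distinct as basis elements; \<open>field_type\<close> fixes the type of the
  coefficients.\<close>

locale word_embedding =
  fixes emb :: "symbol list \<Rightarrow> 'm::monoid_add" and field_type :: "'f::field itself"
  assumes emb_Nil: "emb [] = 0"
    and emb_append: "emb (u @ v) = emb u + emb v"
    and inj_emb: "inj emb"
begin

definition basis :: "symbol list \<Rightarrow> 'm \<Rightarrow>\<^sub>0 'f" where
  "basis w = Poly_Mapping.single (emb w) 1"

lemma basis_Nil: "basis [] = 1"
  by (simp add: basis_def emb_Nil)

lemma basis_append: "basis (u @ v) = basis u * basis v"
  by (simp add: basis_def emb_append mult_single)

lemma basis_prod_list: "basis w = prod_list (map (\<lambda>x. basis [x]) w)"
proof (induction w)
  case Nil
  show ?case
    by (simp add: basis_Nil)
next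
  case (Cons x w)
  have "basis (x # w) = basis [x] * basis w"
    by (simp flip: basis_append)
  then show ?case
    by (simp only: Cons.IH list.map prod_list.Cons)
qed

text \<open>A configuration of length \<open>2\<close> that admits a step is a state together with
  the one letter it reads, so the differences run over the rewriting rules without context.\<close>

definition generators :: "('m \<Rightarrow>\<^sub>0 'f) set" where
  "generators = range (\<lambda>x. basis [Inr x]) \<union> {basis [Inl Halt]} \<union>
    {basis (word c) - basis (word d) | c d. step c d \<and> config_length c = 2}"

lemma finite_generators: "finite generators"
proof -
  let ?C = "{c. config_length c = 2}"
  have "?C \<subseteq> {l. length l \<le> 2} \<times> UNIV \<times> {r. length r \<le> 2}"
    by (auto simp: config_length_def)
  moreover have "finite \<dots>"
    using finite_lists_length_le[of "UNIV :: letter set" 2] by (intro finite_cartesian_product) auto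
  ultimately have "finite ?C"
    by (rule finite_subset)
  \<comment> \<open>By determinism a rule is given by its left-hand side, of which there are
    finitely many.\<close>
  then have "finite ((\<lambda>c. basis (word c) - basis (word (THE d. step c d))) ` ?C)"
    by (rule finite_imageI)
  moreover have "(THE d. step c d) = d" if "step c d" for c d
    using that step_deterministic by blast
  then have "{basis (word c) - basis (word d) | c d. step c d \<and> config_length c = 2} \<subseteq>
      (\<lambda>c. basis (word c) - basis (word (THE d. step c d))) ` ?C"
    by blast
  ultimately have "finite {basis (word c) - basis (word d) | c d. step c d \<and> config_length c = 2}"
    by (rule finite_subset[rotated])
  then show ?thesis
    by (simp add: generators_def)
qed

definition B :: "('m \<Rightarrow>\<^sub>0 'f) set" where
  "B = monoid_algebra.subalgebra hull generators"

section \<open>Configurations that halt lie in the subalgebra\<close>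

lemma generators_subset: "generators \<subseteq> B"
  unfolding B_def by (rule hull_subset)

lemma subalgebra_B: "monoid_algebra.subalgebra B"
  unfolding B_def by (rule monoid_algebra.subalgebra_hull)

lemma finite_generating_set_B: "monoid_algebra.finite_generating_set B generators"
  by (simp add: monoid_algebra.finite_generating_set_def finite_generators B_def)

lemma mult_B: "x \<in> B \<Longrightarrow> y \<in> B \<Longrightarrow> x * y \<in> B"
  using subalgebra_B by (simp add: monoid_algebra.subalgebra_def)

lemma basis_letters_B: "basis (map Inr w) \<in> B"
proof (induction w)
  case Nil
  show ?case
    using subalgebra_B by (simp add: basis_Nil monoid_algebra.subalgebra_def)
next
  case (Cons x w)
  have "basis [Inr x] \<in> B"
    using generators_subset by (auto simp: generators_def)
  with Cons show ?case
    using basis_append[of "[Inr x]" "map Inr w"] mult_B by simp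
qed

lemma step_local:
  assumes "step c d"
  obtains l q r l' q' r' a b where "c = (l @ a, q, r @ b)" "d = (l' @ a, q', r' @ b)"
    "step (l, q, r) (l', q', r')" "config_length (l, q, r) = 2"
  using assms
proof cases
  case (right q x u q' v l r)
  then show ?thesis
    using that[of "[]" l q "[x]" r u q' v] step.right[of q x u q' v "[]" "[]"]
    by (simp add: config_length_def)
next
  case (left q x u q' v l r)
  then show ?thesis
    using that[of "[x]" l q "[]" r u q' v] step.left[of q x u q' v "[]" "[]"]
    by (simp add: config_length_def)
qed

lemma basis_word_context:
  "basis (word (l @ a, q, r @ b)) = basis (map Inr (rev a)) * basis (word (l, q, r)) * basis (map Inr b)"
  by (simp flip: basis_append)

text \<open>The step applies a rule in a context of letters; multiplying the generator of the rule
  by these letters on both sides yields the difference.\<close>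

lemma basis_step_B:
  assumes "step c d"
  shows "basis (word c) - basis (word d) \<in> B"
proof -
  obtain l q r l' q' r' a b where c: "c = (l @ a, q, r @ b)" and d: "d = (l' @ a, q', r' @ b)"
    and step: "step (l, q, r) (l', q', r')" "config_length (l, q, r) = 2"
    using assms by (rule step_local)
  have "basis (word (l, q, r)) - basis (word (l', q', r')) \<in> B"
    using generators_subset step unfolding generators_def by blast
  then have "basis (map Inr (rev a)) * (basis (word (l, q, r)) - basis (word (l', q', r'))) *
      basis (map Inr b) \<in> B"
    by (intro mult_B basis_letters_B)
  then show ?thesis
    unfolding c d basis_word_context by (simp add: algebra_simps)
qed

text \<open>The differences along the run telescope, and the last configuration is a product of
  letters and \<open>Halt\<close>.\<close>

lemma basis_steps_B:
  assumes "steps c (l, Halt, r)"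
  shows "basis (word c) \<in> B"
  using assms
proof (induction rule: converse_rtranclp_induct)
  case base
  have "basis [Inl Halt] \<in> B"
    using generators_subset by (auto simp: generators_def)
  then show ?case
    using basis_word_context[of "[]" l Halt "[]" r] mult_B basis_letters_B by simp
next
  case (step c d)
  have "(basis (word c) - basis (word d)) + basis (word d) \<in> B"
    using basis_step_B[OF step.hyps(1)] step.IH subalgebra_B
    unfolding monoid_algebra.subalgebra_def by (blast intro: monoid_algebra.subspace_add)
  then show ?case
    by simp
qed

text \<open>Products with two or more factors that contain a state have no configurations in their
  support, so nothing needs to be known about them.\<close>

definition marked :: "nat \<Rightarrow> ('m \<Rightarrow>\<^sub>0 'f) set" where
  "marked n = {p. Poly_Mapping.keys p \<subseteq> emb ` {w. n \<le> heads w}}"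

lemma marked_antimono: "m \<le> n \<Longrightarrow> p \<in> marked n \<Longrightarrow> p \<in> marked m"
  by (force simp: marked_def)

lemma marked_basis: "n \<le> heads w \<Longrightarrow> basis w \<in> marked n"
  by (auto simp: marked_def basis_def)

lemma marked_diff: "p \<in> marked n \<Longrightarrow> q \<in> marked n \<Longrightarrow> p - q \<in> marked n"
  using keys_diff[of p q] by (auto simp: marked_def)

lemma marked_mult:
  assumes "p \<in> marked m" "q \<in> marked n"
  shows "p * q \<in> marked (m + n)"
proof -
  have "k \<in> emb ` {w. m + n \<le> heads w}" if k: "k \<in> Poly_Mapping.keys (p * q)" for k
  proof -
    obtain a b where "k = a + b" "a \<in> Poly_Mapping.keys p" "b \<in> Poly_Mapping.keys q"
      using keys_mult[of p q] k by blast
    moreover from this obtain u v where "a = emb u" "m \<le> heads u" "b = emb v" "n \<le> heads v"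
      using assms unfolding marked_def by blast
    ultimately show ?thesis
      by (intro image_eqI[of _ _ "u @ v"]) (simp_all add: emb_append)
  qed
  then show ?thesis
    unfolding marked_def by blast
qed

text \<open>The possible shapes of a product of \<open>n\<close> generators. The count is tied to
  the word only in the first two; for a halting configuration this is what makes the length a lower
  bound on the number of factors.\<close>

inductive product_form :: "nat \<Rightarrow> ('m \<Rightarrow>\<^sub>0 'f) \<Rightarrow> bool" where
  letters: "product_form (length w) (basis (map Inr w))"
| halted: "n = config_length (l, Halt, r) \<Longrightarrow> product_form n (basis (word (l, Halt, r)))"
| difference: "step c d \<Longrightarrow> product_form n (basis (word c) - basis (word d))"
| marked: "p \<in> marked 2 \<Longrightarrow> product_form n p"

text \<open>A generator \<open>y\<close> is multiplied from the left. If both \<open>y\<close> and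
  the remaining product carry state symbols, the result is in \<open>marked 2\<close>. If only
  \<open>y\<close> does, the remaining letters extend its right stack; if \<open>y\<close> is a
  letter, it extends the left stack of the remaining product.\<close>

lemma product_form_prod_list:
  "set ys \<subseteq> generators \<Longrightarrow> product_form (length ys) (prod_list ys)"
proof (induction ys)
  case Nil
  show ?case
    using product_form.letters[of "[]"] by (simp add: basis_Nil)
next
  case (Cons y ys)
  let ?p = "prod_list ys"
  have IH: "product_form (length ys) ?p"
    using Cons by simp
  have step_right: "step (l, q, r @ w) (l', q', r' @ w)" if "step (l, q, r) (l', q', r')"
    for l q r l' q' r' w
    using step_context[OF that, of "[]" w] by simp
  have y: "y \<in> generators"
    using Cons.prems by simp
  have "product_form (Suc (length ys)) (y * ?p)"
  proof (cases "y \<in> marked 1")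
    case True
    then have mult: "product_form (Suc (length ys)) (y * ?p)" if "?p \<in> marked 1"
      using product_form.marked marked_mult[OF True that] by (simp add: numeral_2_eq_2)
    from IH show ?thesis
    proof cases
      case (letters w)
      consider x where "y = basis [Inr x]" | "y = basis (word ([], Halt, []))"
        | c d where "y = basis (word c) - basis (word d)" "step c d"
        using y by (auto simp: generators_def)
      then show ?thesis
      proof cases
        case 1
        have "y * ?p = basis (map Inr (x # w))"
          using 1 letters by (simp flip: basis_append)
        then show ?thesis
          using product_form.letters[of "x # w"] letters by simp
      next
        case 2
        have "y * ?p = basis (word ([], Halt, w))"
          using 2 letters by (simp flip: basis_append)
        then show ?thesis
          using product_form.halted[of _ "[]" w] letters by (simp add: config_length_def)
      next
        case 3
        obtain l q r l' q' r' where cd: "c = (l, q, r)" "d = (l', q', r')"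
          by (cases c, cases d)
        have "y * ?p = basis (word (l, q, r @ w)) - basis (word (l', q', r' @ w))"
          using letters 3 cd by (simp add: left_diff_distrib flip: basis_append)
        then show ?thesis
          using product_form.difference[OF step_right] 3 cd by simp
      qed
    next
      case (halted l r)
      then have "?p \<in> marked 1"
        by (simp only:) (rule marked_basis, rule eq_refl, rule heads_word[symmetric])
      then show ?thesis
        by (rule mult)
    next
      case (difference c d)
      have "?p \<in> marked 1"
        unfolding difference by (intro marked_diff marked_basis) simp_all
      then show ?thesis
        by (rule mult)
    next
      case marked
      then show ?thesis
        by (intro mult marked_antimono[of 1 2]) simp_all
    qed
  next
    case False
    have "basis [Inl Halt] \<in> marked 1"
      by (rule marked_basis) (simp add: heads_def)
    moreover have "basis (word c) - basis (word d) \<in> marked 1" for c d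
      by (intro marked_diff marked_basis) auto
    ultimately obtain x where x: "y = basis [Inr x]"
      using y False by (auto simp: generators_def)
    from IH show ?thesis
    proof cases
      case (letters w)
      then have "y * ?p = basis (map Inr (x # w))"
        using x by (simp flip: basis_append)
      then show ?thesis
        using product_form.letters[of "x # w"] letters by simp
    next
      case (halted l r)
      \<comment> \<open>Left stacks are listed from the top, so a letter multiplied from the left
        goes to the bottom.\<close>
      then have "y * ?p = basis (word (l @ [x], Halt, r))"
        using x by (simp flip: basis_append)
      then show ?thesis
        using product_form.halted[of _ "l @ [x]" r] halted by (simp add: config_length_def)
    next
      case (difference c d)
      obtain l q r l' q' r' where cd: "c = (l, q, r)" "d = (l', q', r')"
        by (cases c, cases d)
      have "y * ?p = basis (word (l @ [x], q, r)) - basis (word (l' @ [x], q', r'))"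
        using difference x cd by (simp add: right_diff_distrib flip: basis_append)
      moreover have "step (l @ [x], q, r) (l' @ [x], q', r')"
        using step_context[of l q r l' q' r' "[x]" "[]"] difference cd by simp
      ultimately show ?thesis
        using product_form.difference[of "(l @ [x], q, r)" "(l' @ [x], q', r')"] by simp
    next
      case marked
      have "y * ?p \<in> marked (0 + 2)"
        unfolding x by (intro marked_mult marked_basis marked) simp
      then have "y * ?p \<in> marked 2"
        by (simp only: add_0)
      then show ?thesis
        by (rule product_form.marked)
    qed
  qed
  then show ?case
    by simp
qed

text \<open>By determinism a run from \<open>c\<close> to a halting configuration passes through
  \<open>d\<close>, for \<open>c\<close> itself is not halting.\<close>

lemma steps_iff:
  assumes "step c d"
  shows "steps c (l, Halt, r) \<longleftrightarrow> steps d (l, Halt, r)"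
proof
  assume "steps c (l, Halt, r)"
  then show "steps d (l, Halt, r)"
  proof (cases rule: converse_rtranclpE)
    case base
    with assms show ?thesis
      using no_step_Halt by simp
  next
    case (step e)
    with step_deterministic[OF assms step(1)] show ?thesis
      by simp
  qed
next
  assume "steps d (l, Halt, r)"
  with assms show "steps c (l, Halt, r)"
    by (rule converse_rtranclp_into_rtranclp)
qed

text \<open>With \<open>T\<close> the embedded configurations leading to the given halting one,
  \<open>coeff_sum T\<close> is \<open>1\<close> at \<open>basis (word c)\<close> but vanishes on
  products of at most \<open>n\<close> generators. Indeed, words without or with several state
  symbols are no configurations, and both sides of a step lie in \<open>T\<close> or neither
  does.\<close>

lemma basis_notin_filtration:
  assumes "steps c (l, Halt, r)" "n < config_length (l, Halt, r)"
  shows "basis (word c) \<notin> monoid_algebra.filtration generators n"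
proof -
  define T where "T = (\<lambda>c. emb (word c)) ` {c. steps c (l, Halt, r)}"
  have T: "emb w \<in> T \<longleftrightarrow> w \<in> word ` {c. steps c (l, Halt, r)}" for w
    using inj_emb by (auto simp: T_def inj_def)
  have T_word: "emb (word d) \<in> T \<longleftrightarrow> steps d (l, Halt, r)" for d
    by (auto simp: T simp del: word.simps)
  have "monoid_algebra.filtration generators n \<subseteq> {p. coeff_sum T p = 0}"
  proof (rule monoid_algebra.filtration_subset[OF subspace_coeff_sum_eq_0])
    fix ys assume ys: "set ys \<subseteq> generators" "length ys \<le> n"
    from product_form_prod_list[OF ys(1)] have "coeff_sum T (prod_list ys) = 0"
    proof cases
      case (letters w)
      have "map Inr w \<notin> word ` {c. steps c (l, Halt, r)}"
        by (metis imageE heads_map_Inr heads_word zero_neq_one)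
      then show ?thesis
        using letters by (simp add: basis_def coeff_sum_single T)
    next
      case (halted l' r')
      \<comment> \<open>The length of \<open>(l', Halt, r')\<close> is the number of factors, which
        is at most \<open>n\<close>. A halting configuration leads only to itself, so this one is
        outside \<open>T\<close>.\<close>
      have "(l', Halt, r') \<noteq> (l, Halt, r)"
        using halted assms(2) ys(2) by auto
      then have "\<not> steps (l', Halt, r') (l, Halt, r)"
        using no_step_Halt by (metis converse_rtranclpE)
      then show ?thesis
        using halted by (simp add: basis_def coeff_sum_single T_word del: word.simps)
    next
      case (difference c d)
      then show ?thesis
        using steps_iff by (simp add: basis_def coeff_sum_diff coeff_sum_single T_word)
    next
      case marked
      have "Poly_Mapping.keys (prod_list ys) \<inter> T = {}"
      proof -
        have "emb w \<notin> T" if "2 \<le> heads w" for w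
          using that heads_word by (auto simp: T simp del: word.simps heads_word)
        then show ?thesis
          using marked by (auto simp: marked_def)
      qed
      then show ?thesis
        by (simp add: coeff_sum_def)
    qed
    then show "prod_list ys \<in> {p. coeff_sum T p = 0}"
      by simp
  qed
  moreover have "coeff_sum T (basis (word c)) = 1"
    using assms(1) by (simp add: basis_def coeff_sum_single T_word del: word.simps)
  ultimately show ?thesis
    by auto
qed

text \<open>Passing to arbitrary generating sets costs constant factors only: \<open>K\<close>
  bounds the degrees of the elements of \<open>Z\<close> in \<open>generators\<close>, and
  \<open>M\<close> bounds the degrees of the symbols in \<open>Y\<close>. Both are absorbed into the
  recursive function given to the machine.\<close>

lemma not_subset_filtration:
  assumes Y: "monoid_algebra.finite_generating_set UNIV Y"
    and Z: "monoid_algebra.finite_generating_set B Z"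
    and g: "recursive_function g"
  shows "\<exists>n. \<not> B \<inter> monoid_algebra.filtration Y n \<subseteq> monoid_algebra.filtration Z (g n)"
proof -
  have "finite Z" "Z \<subseteq> monoid_algebra.subalgebra hull generators"
    using Z hull_subset[of Z] by (auto simp: monoid_algebra.finite_generating_set_def B_def)
  then obtain K where K: "Z \<subseteq> monoid_algebra.filtration generators K"
    by (rule monoid_algebra.finite_subset_filtration)
  have "finite (range (\<lambda>x. basis [x]))"
    "range (\<lambda>x. basis [x]) \<subseteq> monoid_algebra.subalgebra hull Y"
    using Y by (auto simp: monoid_algebra.finite_generating_set_def)
  then obtain M where M: "range (\<lambda>x. basis [x]) \<subseteq> monoid_algebra.filtration Y M"
    by (rule monoid_algebra.finite_subset_filtration)
  have basis: "basis w \<in> monoid_algebra.filtration Y (M * length w)" for w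
    using monoid_algebra.prod_list_in_filtration_mult[of "map (\<lambda>x. basis [x]) w" Y M] M
    by (auto simp: basis_prod_list[of w])
  have "recursive_function (\<lambda>k. Suc (K * g (2 * M * k)))"
    by (intro recursive_function_comp[OF recursive_function_Suc]
      recursive_function_comp[OF recursive_function_times] recursive_function_comp[OF g]
      recursive_function_times)
  from recursive_function_steps[OF this] obtain C where C: "\<And>k. \<exists>c l r. config_length c = C + k \<and> steps c (l, Halt, r) \<and>
      Suc (K * g (2 * M * k)) < config_length (l, Halt, r)"
    by blast
  \<comment> \<open>The constant \<open>C\<close> depends on the function given to the machine, so
    that function cannot refer to it. For the argument \<open>k = C\<close> the input has length
    \<open>2 * k\<close>, which the function anticipates.\<close>
  obtain c l r where c: "config_length c = C + C" "steps c (l, Halt, r)"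
      "Suc (K * g (2 * M * C)) < config_length (l, Halt, r)"
    using C[of C] by blast
  have length: "M * length (word c) = 2 * M * C"
    by (simp add: length_word c(1))
  have "basis (word c) \<in> B \<inter> monoid_algebra.filtration Y (2 * M * C)"
    using basis[of "word c"] basis_steps_B[OF c(2)] unfolding length by blast
  moreover have "basis (word c) \<notin> monoid_algebra.filtration Z (g (2 * M * C))"
    using basis_notin_filtration[OF c(2)] c(3) monoid_algebra.filtration_rescale[OF K]
    by (meson Suc_lessD subsetD)
  ultimately show ?thesis
    by blast
qed

theorem distorted_subalgebra:
  "\<exists>B :: ('m \<Rightarrow>\<^sub>0 'f) set. monoid_algebra.subalgebra B \<and> monoid_algebra.finitely_generated B \<and>
    monoid_algebra.distorted UNIV B \<and>
    (\<forall>d. monoid_algebra.distortion_function UNIV B d \<longrightarrow>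
      \<not> (\<exists>g. recursive_function g \<and> (\<forall>n. d n \<le> g n)))"
proof (intro exI[of _ B] conjI allI impI)
  show "monoid_algebra.finitely_generated B"
    using finite_generating_set_B unfolding monoid_algebra.finitely_generated_def by (rule exI)
  show "monoid_algebra.distorted UNIV B"
    by (rule monoid_algebra.unbounded_distortion(1)) (rule not_subset_filtration)
  show "\<not> (\<exists>g. recursive_function g \<and> (\<forall>n. d n \<le> g n))"
    if d: "monoid_algebra.distortion_function UNIV B d" for d
    by (rule monoid_algebra.unbounded_distortion(2)[OF _ d]) (rule not_subset_filtration)
qed (rule subalgebra_B)

end

section \<open>Free submonoids\<close>

text \<open>A prefix code: each symbol becomes a block of \<open>False\<close> closed by
  \<open>True\<close>. Words over all symbols of the machine thus embed into the words over two
  letters.\<close>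

definition encode :: "symbol list \<Rightarrow> bool list" where
  "encode w = concat (map (\<lambda>x. replicate (to_nat x) False @ [True]) w)"

lemma inj_encode: "inj encode"
proof -
  have unary: "i = j \<and> u = v"
    if "replicate i False @ True # u = replicate j False @ True # v" for i j u v
    using that
  proof (induction i arbitrary: j)
    case 0
    then show ?case
      by (cases j) auto
  next
    case (Suc i)
    then show ?case
      by (cases j) auto
  qed
  have "u = v" if "encode u = encode v" for u v
    using that
  proof (induction u arbitrary: v)
    case Nil
    then show ?case
      by (cases v) (auto simp: encode_def)
  next
    case (Cons x u)
    then obtain y v' where v: "v = y # v'"
      by (cases v) (auto simp: encode_def)
    have "to_nat x = to_nat y \<and> encode u = encode v'"
      using Cons.prems unfolding v by (intro unary) (simp add: encode_def)
    with Cons.IH show ?case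
      by (simp add: v)
  qed
  then show ?thesis
    by (auto intro: injI)
qed

lemma distorted_subalgebra_of_free_submonoid:
  fixes h :: "bool list \<Rightarrow> 'm::monoid_add"
  assumes "h [] = 0" "\<And>u v. h (u @ v) = h u + h v" "inj h"
  shows "\<exists>B :: ('m \<Rightarrow>\<^sub>0 'f::field) set.
    monoid_algebra.subalgebra B \<and> monoid_algebra.finitely_generated B \<and>
    monoid_algebra.distorted UNIV B \<and>
    (\<forall>d. monoid_algebra.distortion_function UNIV B d \<longrightarrow>
      \<not> (\<exists>g. recursive_function g \<and> (\<forall>n. d n \<le> g n)))"
proof -
  interpret word_embedding "\<lambda>w. h (encode w)" "TYPE('f)"
    by standard (use assms inj_encode in \<open>auto simp: encode_def[abs_def] inj_def\<close>)
  show ?thesis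
    by (rule distorted_subalgebra)
qed

text \<open>The action of a free group on pairs of integers, given by the matrices with rows
  \<open>(1, 1), (0, 1)\<close> for \<open>a\<close> and \<open>(1, 0), (1, 1)\<close> for \<open>b\<close>.\<close>

fun act :: "'x \<Rightarrow> 'x \<Rightarrow> 'x \<times> bool \<Rightarrow> int \<times> int \<Rightarrow> int \<times> int" where
  "act a b (x, e) (p, q) =
    (if x = a then (if e then p + q else p - q, q)
     else if x = b then (p, if e then q + p else q - p)
     else (p, q))"

lemma act_cancel: "act a b (x, e) (act a b (x, \<not> e) z) = z"
  by (cases z) auto

lemma free_group_eq_act: "free_group_eq u v \<Longrightarrow> foldr (act a b) u = foldr (act a b) v"
  by (induction rule: free_group_eq.induct) (auto simp: fun_eq_iff act_cancel)

text \<open>Euclid's algorithm recovers the word from its action on \<open>(1, 1)\<close>. All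
  coordinates stay positive, so the first coordinate is larger if the outermost letter is
  \<open>a\<close>, the second if it is \<open>b\<close>, and they agree only for the empty
  word.\<close>

lemma free_group_eq_positive:
  assumes "a \<noteq> b"
    and "free_group_eq (map (\<lambda>e. (if e then a else b, True)) u) (map (\<lambda>e. (if e then a else b, True)) v)"
  shows "u = v"
proof -
  define f where "f = (\<lambda>u. foldr (act a b) (map (\<lambda>e. (if e then a else b, True)) u) (1, 1))"
  have f: "f [] = (1, 1)"
    "f (e # u) = (if e then (fst (f u) + snd (f u), snd (f u)) else (fst (f u), snd (f u) + fst (f u)))"
    for e u
    using assms(1) by (cases "f u"; simp add: f_def)+
  have pos: "0 < fst (f u) \<and> 0 < snd (f u)" for u
    by (induction u) (auto simp: f)
  have "u = v" if "f u = f v" for u v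
    using that
  proof (induction u arbitrary: v)
    case Nil
    show ?case
    proof (cases v)
      case (Cons e v')
      then show ?thesis
        using Nil pos[of v'] by (auto simp: f split: if_splits)
    qed simp
  next
    case (Cons e u)
    show ?case
    proof (cases v)
      case Nil
      then show ?thesis
        using Cons.prems pos[of u] by (auto simp: f split: if_splits)
    next
      case v: (Cons e' v')
      have "e = e' \<and> f u = f v'"
        using Cons.prems pos[of u] pos[of v'] by (auto simp: v f prod_eq_iff split: if_splits)
      with Cons.IH show ?thesis
        by (simp add: v)
    qed
  qed
  moreover have "f u = f v"
    using free_group_eq_act[OF assms(2), of a b] by (simp add: f_def)
  ultimately show ?thesis .
qed

theorem theorem4:
  assumes "card (UNIV :: 'x::finite set) \<ge> 2"
  shows "(\<exists>B :: ('x, 'f::field) free_algebra set.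
            monoid_algebra.subalgebra B \<and> monoid_algebra.finitely_generated B \<and>
            monoid_algebra.distorted UNIV B \<and>
            (\<forall>d. monoid_algebra.distortion_function UNIV B d \<longrightarrow>
              \<not> (\<exists>g. recursive_function g \<and> (\<forall>n. d n \<le> g n))))
       \<and> (\<exists>B :: ('x, 'f) free_group_algebra set.
            monoid_algebra.subalgebra B \<and> monoid_algebra.finitely_generated B \<and>
            monoid_algebra.distorted UNIV B \<and>
            (\<forall>d. monoid_algebra.distortion_function UNIV B d \<longrightarrow>
              \<not> (\<exists>g. recursive_function g \<and> (\<forall>n. d n \<le> g n))))"
proof -
  obtain a b :: 'x where ab: "a \<noteq> b"
    using assms by (auto simp: card_le_Suc_iff numeral_2_eq_2)
  show ?thesis
  proof
    show "\<exists>B :: ('x, 'f::field) free_algebra set.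
            monoid_algebra.subalgebra B \<and> monoid_algebra.finitely_generated B \<and>
            monoid_algebra.distorted UNIV B \<and>
            (\<forall>d. monoid_algebra.distortion_function UNIV B d \<longrightarrow>
              \<not> (\<exists>g. recursive_function g \<and> (\<forall>n. d n \<le> g n)))"
    proof (rule distorted_subalgebra_of_free_submonoid)
      have "inj (\<lambda>e. if e then a else b)"
        using ab by (auto simp: inj_def)
      then show "inj (\<lambda>u. Word (map (\<lambda>e. if e then a else b) u))"
        by (auto simp: inj_def)
    qed (simp_all add: zero_free_monoid_def plus_free_monoid_def)
    let ?w = "map (\<lambda>e. (if e then a else b, True))"
    show "\<exists>B :: ('x, 'f) free_group_algebra set.
            monoid_algebra.subalgebra B \<and> monoid_algebra.finitely_generated B \<and>
            monoid_algebra.distorted UNIV B \<and>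
            (\<forall>d. monoid_algebra.distortion_function UNIV B d \<longrightarrow>
              \<not> (\<exists>g. recursive_function g \<and> (\<forall>n. d n \<le> g n)))"
    proof (rule distorted_subalgebra_of_free_submonoid)
      show "inj (\<lambda>u. abs_free_group (?w u))"
        using free_group_eq_positive[OF ab] by (auto intro!: injI simp: free_group.abs_eq_iff)
    qed (simp_all add: zero_free_group_def plus_free_group.abs_eq)
  qed
qed

end
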